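(* Let $\Gamma$ be an infinite countable group generated by a finite symmetric set $S$, acting by measure preserving maps on a standard Borel probability space $(X,\mu)$, let $\mathcal{R}=\{(x,gx):x\in X,\ g\in\Gamma\}$ be the orbit relation, and let $\mathcal{S}$ be a subrelation of $\mathcal{R}$. For $(x,y)\in\mathcal{R}$ and $n\in\mathbb{N}$ let $$p_{n,x,[y]_{\mathcal{S}}}=\mathbb{P}\big((g_nx,y)\in\mathcal{S}\big),$$ where $(g_n)$ is the lazy random walk on $\mathrm{Cay}(\Gamma,S)$ started at the identity. Then for $\mu$-almost every $y\in X$ and for every $x\in\Gamma y$ the limit $$\rho^{\mathcal{S}}(x,[y]_{\mathcal{S}})=\lim_{n\to\infty}p_{n,x,[y]_{\mathcal{S}}}^{1/n}$$ exists and is independent of $x$. Moreover, if $\mathcal{S}$ is ergodic, or if $\mathcal{S}$ is normal in $\mathcal{R}$ and $\mathcal{R}$ is ergodic, then $\rho^{\mathcal{S}}$ (as a function of $y$) is $\mu$-almost surely constant.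
   Context: A subrelation of $\mathcal{R}$ is a Borel subset $\mathcal{S}\subseteq\mathcal{R}$ that is an equivalence relation on $X$; $[x]_{\mathcal{S}}$ denotes the $\mathcal{S}$-class of $x$. An equivalence relation is ergodic if every measurable set which is a union of its classes (up to null sets) has measure $0$ or $1$. The lazy random walk stays in place at each step with a fixed probability in $(0,1)$ and otherwise moves to a neighbour along a uniformly chosen generator in $S$. Let $\mathrm{End}_{\mathcal{R}}(\mathcal{S})$ be the set of measurable $\phi:X\to X$ such that for almost every $x\in X$ one has $\phi(x)\in[x]_{\mathcal{R}}$ and $\phi([x]_{\mathcal{S}})\subseteq[\phi(x)]_{\mathcal{S}}$. The subrelation $\mathcal{S}$ is normal in $\mathcal{R}$ if there is a countable $D\subseteq\mathrm{End}_{\mathcal{R}}(\mathcal{S})$ with $[x]_{\mathcal{R}}=\bigcup_{\phi\in D}\phi([x]_{\mathcal{S}})$ for almost every $x\in X$. *)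

theory Defs
  imports "HOL-Probability.Probability" "HOL-Algebra.Generated_Groups" "HOL-Algebra.Group_Action"
begin

section \<open>Standard Borel spaces and measure preserving actions\<close>

definition standard_borel :: "'a measure \<Rightarrow> bool" where
  "standard_borel M \<longleftrightarrow>
     (\<exists>T. topspace T = space M \<and> completely_metrizable_space T \<and> second_countable T \<and>
          sets M = sigma_sets (space M) {U. openin T U})"

text \<open>The action is a \<^locale>\<open>group_action\<close> on the whole space \<^term>\<open>space M\<close>; it need not be free.\<close>

definition pmp_action ::
  "('g, 'b) monoid_scheme \<Rightarrow> 'a measure \<Rightarrow> ('g \<Rightarrow> 'a \<Rightarrow> 'a) \<Rightarrow> bool" where
  "pmp_action G M \<phi> \<longleftrightarrow>
     group_action G (space M) \<phi> \<and>
     (\<forall>g\<in>carrier G. \<phi> g \<in> measurable M M \<and> distr M M (\<phi> g) = M)"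


section \<open>Equivalence relations\<close>

definition orbit_relation ::
  "('g, 'b) monoid_scheme \<Rightarrow> 'a measure \<Rightarrow> ('g \<Rightarrow> 'a \<Rightarrow> 'a) \<Rightarrow> ('a \<times> 'a) set" where
  "orbit_relation G M \<phi> = {(x, \<phi> g x) | x g. x \<in> space M \<and> g \<in> carrier G}"

definition subrelation :: "'a measure \<Rightarrow> ('a \<times> 'a) set \<Rightarrow> ('a \<times> 'a) set \<Rightarrow> bool" where
  "subrelation M R S \<longleftrightarrow> S \<subseteq> R \<and> S \<in> sets (M \<Otimes>\<^sub>M M) \<and> equiv (space M) S"

text \<open>
  In this section the class of \<^term>\<open>x\<close> under \<^term>\<open>E\<close> is \<^term>\<open>E `` {x}\<close>, so \<^term>\<open>E `` B = B\<close>
  says that \<^term>\<open>B\<close> is a union of \<^term>\<open>E\<close>-classes. The set \<^term>\<open>B\<close> below is not required to be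
  measurable, only to agree with the measurable set \<^term>\<open>A\<close> off a null set.
\<close>

definition ergodic_relation :: "'a measure \<Rightarrow> ('a \<times> 'a) set \<Rightarrow> bool" where
  "ergodic_relation M E \<longleftrightarrow>
     (\<forall>A\<in>sets M.
        (\<exists>B\<subseteq>space M. E `` B = B \<and> (AE x in M. x \<in> A \<longleftrightarrow> x \<in> B)) \<longrightarrow>
        measure M A = 0 \<or> measure M A = 1)"

definition End_rel :: "'a measure \<Rightarrow> ('a \<times> 'a) set \<Rightarrow> ('a \<times> 'a) set \<Rightarrow> ('a \<Rightarrow> 'a) set" where
  "End_rel M R S =
     {f \<in> measurable M M. AE x in M. f x \<in> R `` {x} \<and> f ` (S `` {x}) \<subseteq> S `` {f x}}"

definition normal_subrelation :: "'a measure \<Rightarrow> ('a \<times> 'a) set \<Rightarrow> ('a \<times> 'a) set \<Rightarrow> bool" where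
  "normal_subrelation M R S \<longleftrightarrow>
     (\<exists>D\<subseteq>End_rel M R S. countable D \<and> (AE x in M. R `` {x} = (\<Union>f\<in>D. f ` (S `` {x}))))"


section \<open>The lazy random walk and the co-spectral radius\<close>

text \<open>
  The walk stays in place with probability \<open>a\<close> and otherwise follows an edge \<open>(g, g s)\<close> of the
  Cayley graph, with \<open>s\<close> uniform in \<open>S\<close>. Since the increments are independent and identically
  distributed, the edges \<open>(g, s g)\<close> would give the same law at each time.
\<close>

definition lazy_step :: "('g, 'b) monoid_scheme \<Rightarrow> 'g set \<Rightarrow> real \<Rightarrow> 'g \<Rightarrow> 'g pmf" where
  "lazy_step G S a g =
     bind_pmf (bernoulli_pmf a)
       (\<lambda>stay. if stay then return_pmf g else map_pmf (\<lambda>s. g \<otimes>\<^bsub>G\<^esub> s) (pmf_of_set S))"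

text \<open>\<open>lazy_walk G S a n\<close> is the law of \<open>g\<^sub>n\<close>.\<close>

primrec lazy_walk :: "('g, 'b) monoid_scheme \<Rightarrow> 'g set \<Rightarrow> real \<Rightarrow> nat \<Rightarrow> 'g pmf" where
  "lazy_walk G S a 0 = return_pmf \<one>\<^bsub>G\<^esub>"
| "lazy_walk G S a (Suc n) = bind_pmf (lazy_walk G S a n) (lazy_step G S a)"

definition hitting_prob ::
  "('g, 'b) monoid_scheme \<Rightarrow> 'g set \<Rightarrow> real \<Rightarrow> ('g \<Rightarrow> 'a \<Rightarrow> 'a) \<Rightarrow> ('a \<times> 'a) set
     \<Rightarrow> nat \<Rightarrow> 'a \<Rightarrow> 'a \<Rightarrow> real" where
  "hitting_prob G S a \<phi> E n x y =
     measure_pmf.prob (lazy_walk G S a n) {g. (\<phi> g x, y) \<in> E}"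

text \<open>Meaningful only where the sequence converges.\<close>

definition cospectral_radius ::
  "('g, 'b) monoid_scheme \<Rightarrow> 'g set \<Rightarrow> real \<Rightarrow> ('g \<Rightarrow> 'a \<Rightarrow> 'a) \<Rightarrow> ('a \<times> 'a) set
     \<Rightarrow> 'a \<Rightarrow> 'a \<Rightarrow> real" where
  "cospectral_radius G S a \<phi> E x y = lim (\<lambda>n. root n (hitting_prob G S a \<phi> E n x y))"

end

theory Submission
  imports Defs "HOL-Real_Asymp.Real_Asymp"
begin

text \<open>
  Write \<open>A\<^sub>n\<close> for the averaging operator of the \<open>n\<close>-step walk on the orbits, restricted to steps that stay
  within a class of the subrelation, and \<open>f\<^sub>n = A\<^sub>n 1\<close> for the probability of being in the starting class
  at time \<open>n\<close>. The walk from \<open>y\<close> returns to its class at points where \<open>f\<^sub>n\<close> may be much smaller than at \<open>y\<close>,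
  so \<open>f\<^sub>n(y)\<close> need not be supermultiplicative in \<open>n\<close>. It is so on average: \<open>A\<^sub>m A\<^sub>n \<le> A\<^bsub>m+n\<^esub>\<close>, the operators are
  symmetric because the action preserves the measure (mass transport), and Jensen's inequality gives
  \<open>f\<^sub>n\<^sup>2 / f\<^bsub>2n\<^esub> \<le> f\<^sub>n\<^sup>2 / (A\<^sub>n f\<^sub>n) \<le> A\<^sub>n(1/f\<^sub>n)\<close>, whose integral is \<open>\<integral> (1/f\<^sub>n) A\<^sub>n 1 = 1\<close>. Iterating this argument
  yields \<open>\<integral> f\<^sub>n f\<^bsub>kn\<^esub>\<^bsup>-1/k\<^esup> \<le> 1\<close> for all \<open>k\<close> (\<open>return_prob_ratio_integral_le_1\<close>).

  By Markov's inequality and the Borel--Cantelli lemma, almost surely, for each \<open>k\<close> and all large \<open>n\<close>,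
  \<open>f\<^bsub>kn\<^esub>\<^bsup>1/k\<^esup> \<ge> f\<^sub>n / n\<^sup>2\<close>. Together with \<open>f\<^bsub>n+1\<^esub> \<ge> a f\<^sub>n\<close>, which is laziness, this forces \<open>ln f\<^sub>n / n\<close> to
  converge (\<open>log_rate_exists\<close>). Moving the starting point along the orbit changes the probabilities by a
  constant factor and a bounded time shift, so the limit does not depend on it (\<open>hit_rate\<close>). The limit
  depends only on the class, which settles the case of an ergodic subrelation.

  In the normal case let \<open>F\<close> be one of the endomorphisms and let \<open>Z\<close> be the set where \<open>F\<close> agrees, up to the
  subrelation, with the translation by a fixed \<open>g\<close>. The same use of symmetry and Jensen's inequality
  gives \<open>\<integral>\<^sub>Z f\<^sub>n\<^sup>2 / (A\<^bsub>2n\<^esub> 1\<^sub>Z) \<le> 1\<close> (\<open>return_to_subset_integral_le_1\<close>): at almost every point of \<open>Z\<close> the walk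
  hits the part of the class in \<open>Z\<close> with the same exponential rate as the whole class, at even times. Translating by
  \<open>g\<close>, the rate at \<open>F y\<close> is at least the rate at \<open>y\<close>. The endomorphisms carry the class of \<open>y\<close> to every
  point of the orbit, so the rate is monotone between any two points of an orbit, in both directions,
  hence constant on orbits (\<open>AE_rate_orbit_invariant\<close>), and ergodicity of the orbit relation applies.
\<close>

section \<open>Exponential rates of real sequences\<close>

text \<open>
  Doubling and rounding: going from \<open>n\<close> to \<open>2\<^sup>i n\<close> costs at most \<open>\<Sum>\<^sub>j 1 / sqrt (2\<^sup>j n)\<close>, a geometric sum.
  A given large \<open>N\<close> lies just above \<open>k m\<close> for some \<open>m = 2\<^sup>i n\<close> and some \<open>k\<close> between \<open>K\<close> and \<open>2 K\<close>, and
  the remainder, shorter than \<open>m\<close>, costs \<open>B / K\<close>. So \<open>b N\<close> is eventually at most \<open>b n + \<epsilon>\<close>. Only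
  finitely many multipliers \<open>k\<close> are used for a given \<open>\<epsilon>\<close>; hence no uniformity in \<open>k\<close> is assumed.
\<close>

lemma convergent_of_almost_decreasing_along_multiples:
  fixes b :: "nat \<Rightarrow> real"
  assumes nonneg: "\<And>n. 0 \<le> b n" and le_B: "\<And>n. b n \<le> B"
    and multiples: "\<And>k. k \<ge> 1 \<Longrightarrow> eventually (\<lambda>n. b (k * n) \<le> b n + 1 / sqrt n) sequentially"
    and gaps: "\<And>n r. real (n + r) * b (n + r) \<le> real r * B + real n * b n"
  shows "convergent b"
proof -
  have B: "0 \<le> B" using nonneg[of 0] le_B[of 0] by simp
  have key: "\<exists>N0. \<forall>n\<ge>N0. eventually (\<lambda>N. b N \<le> b n + e) sequentially" if e: "e > 0" for e
  proof -
    obtain K where K: "K \<ge> 1" "B / real K \<le> e / 2"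
    proof
      let ?K = "nat \<lceil>2 * B / e\<rceil> + 1"
      have "2 * B / e \<le> real ?K" using B e by linarith
      then show "B / real ?K \<le> e / 2" using e by (simp add: field_simps)
    qed simp
    have "eventually (\<lambda>n. \<forall>k\<in>{1..2 * K}. b (k * n) \<le> b n + 1 / sqrt n) sequentially"
      using multiples by (intro eventually_ball_finite) auto
    moreover have "eventually (\<lambda>n. 5 / sqrt (real n) \<le> e / 2) sequentially"
      using e by real_asymp
    ultimately have "eventually (\<lambda>n. n \<ge> 1 \<and> (\<forall>k\<in>{1..2 * K}. b (k * n) \<le> b n + 1 / sqrt n)
        \<and> 5 / sqrt (real n) \<le> e / 2) sequentially"
      using eventually_ge_at_top[of 1] by eventually_elim auto
    then obtain N0 where N0: "\<And>n. n \<ge> N0 \<Longrightarrow> n \<ge> 1"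
        "\<And>n k. n \<ge> N0 \<Longrightarrow> k \<in> {1..2 * K} \<Longrightarrow> b (k * n) \<le> b n + 1 / sqrt n"
        "\<And>n. n \<ge> N0 \<Longrightarrow> 5 / sqrt (real n) \<le> e / 2"
      unfolding eventually_sequentially by blast
    have "b N \<le> b n + e" if n: "n \<ge> N0" and N: "N \<ge> K * n" for n N
    proof -
      have n1: "n \<ge> 1" using N0(1) n by simp
      \<comment> \<open>The constant 4 makes \<open>c / sqrt m\<close> drop by at least \<open>1 / sqrt m\<close> when \<open>m\<close> is doubled.\<close>
      have doubling: "b (2 ^ i * n) + 4 / sqrt (2 ^ i * n) \<le> b n + 4 / sqrt n" for i
      proof (induction i)
        case (Suc i)
        define m where "m = 2 ^ i * n"
        have m: "m \<ge> N0" "m \<ge> 1" using n n1 unfolding m_def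
          by (auto intro: order_trans[OF n] simp: Suc_le_eq)
        have "b (2 * m) \<le> b m + 1 / sqrt m" using N0(2)[OF m(1), of 2] K by simp
        moreover have "1 / sqrt m + 4 / sqrt (2 * m) \<le> 4 / sqrt m"
        proof -
          have "4 / 3 \<le> sqrt 2" by (rule real_le_rsqrt) (simp add: power2_eq_square)
          then show ?thesis using m(2) by (simp add: real_sqrt_mult field_simps)
        qed
        ultimately have "b (2 * m) + 4 / sqrt (2 * m) \<le> b m + 4 / sqrt m" by linarith
        moreover have "2 ^ Suc i * n = 2 * m" by (simp add: m_def)
        ultimately show ?case using Suc.IH unfolding m_def by (simp add: mult.assoc)
      qed simp
      have "N div (K * n) \<ge> 1" using N K n1 by (simp add: div_greater_zero_iff Suc_le_eq)
      then obtain i where i: "2 ^ i \<le> N div (K * n)" "N div (K * n) < 2 ^ (i + 1)"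
        using ex_power_ivl1[of 2 "N div (K * n)"] by auto
      define m where "m = 2 ^ i * n"
      define k where "k = N div m"
      define r where "r = N mod m"
      have Kn: "K * n > 0" using K n1 by simp
      have m: "m \<ge> N0" "m \<ge> 1" using n n1 unfolding m_def
        by (auto intro: order_trans[OF n] simp: Suc_le_eq)
      have "2 ^ i * (K * n) \<le> N" using i(1) Kn by (simp add: less_eq_div_iff_mult_less_eq)
      then have k_ge: "K \<le> k" using m(2) unfolding k_def
        by (simp add: less_eq_div_iff_mult_less_eq m_def mult_ac)
      have "N < 2 ^ (i + 1) * (K * n)" using i(2) Kn by (simp add: div_less_iff_less_mult)
      then have k_le: "k \<le> 2 * K" using m(2) unfolding k_def
        by (intro less_imp_le) (simp add: div_less_iff_less_mult m_def mult_ac)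
      have N_eq: "N = k * m + r" by (simp add: k_def r_def)
      have r: "r \<le> m" using m(2) by (simp add: r_def less_imp_le)
      have N_pos: "real N > 0" using N Kn by linarith
      have "real N * b N \<le> real r * B + real (k * m) * b (k * m)"
        using gaps[of "k * m" r] N_eq by simp
      also have "real r * B \<le> real N * (B / real K)"
      proof -
        have "real K * real r \<le> real k * real m" using k_ge r by (intro mult_mono) auto
        also have "\<dots> \<le> real N" by (simp add: N_eq)
        finally have "real K * real r * B \<le> real N * B" using B by (intro mult_right_mono)
        then show ?thesis using K by (simp add: field_simps)
      qed
      also have "real (k * m) * b (k * m) \<le> real N * b (k * m)"
        using nonneg by (intro mult_right_mono) (auto simp: N_eq)
      finally have "real N * b N \<le> real N * (B / real K + b (k * m))" by (simp add: algebra_simps)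
      then have "b N \<le> B / real K + b (k * m)" using N_pos by simp
      also have "b (k * m) \<le> b m + 1 / sqrt m" using N0(2) m(1) k_ge k_le K by simp
      also have "b m \<le> b n + 4 / sqrt n"
      proof -
        have "0 \<le> 4 / sqrt (2 ^ i * n)" by simp
        then show ?thesis using doubling[of i] unfolding m_def by linarith
      qed
      also have "1 / sqrt m \<le> 1 / sqrt n" using n1 by (intro divide_left_mono) (auto simp: m_def)
      finally have "b N \<le> B / real K + (b n + 4 / sqrt n + 1 / sqrt n)" by simp
      moreover have "4 / sqrt n + 1 / sqrt n = 5 / sqrt n" by (simp add: add_divide_distrib[symmetric])
      ultimately show ?thesis using K(2) N0(3)[OF n] by linarith
    qed
    then show ?thesis unfolding eventually_sequentially by blast
  qed
  \<comment> \<open>The limit superior of \<open>b\<close>; by the claim it is at most \<open>b n + \<epsilon>\<close> for all large \<open>n\<close>.\<close>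
  define A where "A = {c. eventually (\<lambda>N. b N \<le> c) sequentially}"
  define L where "L = Inf A"
  have "B \<in> A" using le_B by (simp add: A_def)
  have bdd: "bdd_below A"
  proof (rule bdd_belowI[of _ 0])
    fix c assume "c \<in> A"
    then obtain N where "b N \<le> c" unfolding A_def eventually_sequentially by blast
    then show "0 \<le> c" using nonneg[of N] by simp
  qed
  have "b \<longlonglongrightarrow> L"
  proof (rule LIMSEQ_I)
    fix e :: real assume e: "e > 0"
    then obtain N0 where N0: "\<And>n. n \<ge> N0 \<Longrightarrow> eventually (\<lambda>N. b N \<le> b n + e / 2) sequentially"
      using key[of "e / 2"] by auto
    have lower: "L \<le> b n + e / 2" if "n \<ge> N0" for n
      using N0[OF that] bdd unfolding L_def by (intro cInf_lower) (auto simp: A_def)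
    obtain c where "c \<in> A" "c < L + e"
      using e \<open>B \<in> A\<close> cInf_lessD[of A "L + e"] unfolding L_def by auto
    then obtain N1 where N1: "\<And>n. n \<ge> N1 \<Longrightarrow> b n < L + e"
      unfolding A_def eventually_sequentially by force
    show "\<exists>no. \<forall>n\<ge>no. norm (b n - L) < e"
    proof (intro exI allI impI)
      fix n assume "n \<ge> max N0 N1"
      then show "norm (b n - L) < e" using lower[of n] N1[of n] e by (auto simp: abs_less_iff)
    qed
  qed
  then show ?thesis by (auto simp: convergent_def)
qed

text \<open>
  For \<open>b n = - ln (f n) / n\<close> the hypothesis on powers says \<open>b (k n) \<le> b n + 2 ln n / n\<close>. The value \<open>f 0 = 1\<close>
  makes \<open>n b n = - ln (f n)\<close> hold at \<open>n = 0\<close> as well.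
\<close>

lemma log_rate_exists:
  fixes f :: "nat \<Rightarrow> real"
  assumes f_pos: "\<And>n. 0 < f n" and f_le: "\<And>n. f n \<le> 1"
    and c: "0 < c" and slow: "\<And>n. c * f n \<le> f (Suc n)" and f0: "f 0 = 1"
    and powers: "\<And>k. k \<ge> 1 \<Longrightarrow>
      eventually (\<lambda>n. f n * f (k * n) powr (- 1 / real k) \<le> real n ^ 2) sequentially"
  shows "\<exists>l. (\<lambda>n. ln (f n) / real n) \<longlonglongrightarrow> l"
proof -
  define b where "b n = - ln (f n) / real n" for n
  define B where "B = - ln c"
  have c1: "c \<le> 1" using slow[of 0] f0 f_le[of 1] by simp
  have ln_le: "- ln (f (n + r)) \<le> real r * B - ln (f n)" for n r
  proof (induction r)
    case (Suc r)
    have "ln (c * f (n + r)) \<le> ln (f (n + Suc r))"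
      using slow[of "n + r"] c f_pos by (intro ln_mono) (auto simp: mult_pos_pos)
    then have "ln c + ln (f (n + r)) \<le> ln (f (n + Suc r))"
      using c f_pos[of "n + r"] by (simp add: ln_mult)
    then show ?case using Suc.IH by (simp add: B_def algebra_simps)
  qed simp
  have nb: "real n * b n = - ln (f n)" for n
    using f0 by (cases "n = 0") (auto simp: b_def)
  have "convergent b"
  proof (rule convergent_of_almost_decreasing_along_multiples)
    fix n
    show "0 \<le> b n" using f_pos[of n] f_le[of n] by (simp add: b_def divide_nonpos_nonneg)
    show "b n \<le> B"
    proof (cases "n = 0")
      case True then show ?thesis using c c1 by (simp add: b_def B_def)
    next
      case False
      then show ?thesis using ln_le[of 0 n] f0 by (simp add: b_def field_simps)
    qed
  next
    fix k :: nat assume k: "k \<ge> 1"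
    have "eventually (\<lambda>n. 2 * ln (real n) / real n \<le> 1 / sqrt (real n)) sequentially"
      by real_asymp
    with powers[OF k] eventually_gt_at_top[of 0]
    show "eventually (\<lambda>n. b (k * n) \<le> b n + 1 / sqrt n) sequentially"
    proof eventually_elim
      case (elim n)
      have "ln (f n * f (k * n) powr (- 1 / real k)) \<le> ln (real n ^ 2)"
        using elim f_pos[of n] f_pos[of "k * n"] by (intro ln_mono) auto
      then have "ln (f n) - ln (f (k * n)) / real k \<le> 2 * ln (real n)"
        using elim f_pos[of n] f_pos[of "k * n"] by (simp add: ln_mult ln_powr ln_realpow)
      then have "(ln (f n) - ln (f (k * n)) / real k) / real n \<le> 2 * ln (real n) / real n"
        using elim by (intro divide_right_mono) auto
      also have "\<dots> \<le> 1 / sqrt n" by (rule elim)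
      finally show ?case using elim k by (simp add: b_def field_simps)
    qed
  next
    fix n r show "real (n + r) * b (n + r) \<le> real r * B + real n * b n"
      unfolding nb using ln_le[of n r] by simp
  qed
  then obtain L where "b \<longlonglongrightarrow> L" by (auto simp: convergent_def)
  then have "(\<lambda>n. - b n) \<longlonglongrightarrow> - L" by (rule tendsto_minus)
  then show ?thesis by (auto simp: b_def)
qed

text \<open>The index of \<open>f\<close> and the normalization may be different affine functions of \<open>n\<close>.\<close>

lemma log_rate_affine:
  fixes f :: "nat \<Rightarrow> real"
  assumes "(\<lambda>n. ln (f n) / real n) \<longlonglongrightarrow> l" and p: "p \<ge> 1" and "r \<ge> 1"
  shows "(\<lambda>n. ln (f (p * n + q)) / real (r * n + s)) \<longlonglongrightarrow> real p * l / real r"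
proof -
  have "filterlim (\<lambda>n. p * n + q) at_top sequentially"
    using p by (intro filterlim_subseq) (auto simp: strict_mono_def)
  from filterlim_compose[OF assms(1) this]
  have "(\<lambda>n. ln (f (p * n + q)) / real (p * n + q)) \<longlonglongrightarrow> l" .
  moreover have "(\<lambda>n. real (p * n + q) / real (r * n + s)) \<longlonglongrightarrow> real p * inverse (real r)"
    using p \<open>r \<ge> 1\<close> by real_asymp
  ultimately have "(\<lambda>n. ln (f (p * n + q)) / real (p * n + q) * (real (p * n + q) / real (r * n + s)))
      \<longlonglongrightarrow> l * (real p / real r)"
    unfolding divide_inverse[of "real p"] by (rule tendsto_mult)
  moreover have "eventually (\<lambda>n. ln (f (p * n + q)) / real (p * n + q) * (real (p * n + q) / real (r * n + s))
      = ln (f (p * n + q)) / real (r * n + s)) sequentially"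
    using eventually_gt_at_top[of 0]
  proof eventually_elim
    case (elim n)
    then have "0 < p * n + q" using p by simp
    then show ?case by (simp del: of_nat_add of_nat_mult)
  qed
  ultimately have "(\<lambda>n. ln (f (p * n + q)) / real (r * n + s)) \<longlonglongrightarrow> l * (real p / real r)"
    by (rule Lim_transform_eventually)
  then show ?thesis by (simp add: mult.commute)
qed

text \<open>The factors \<open>c\<close> and \<open>n\<^sup>2\<close> and the shift \<open>q\<close> are negligible on the exponential scale.\<close>

lemma log_rate_mono:
  fixes u v :: "nat \<Rightarrow> real"
  assumes u: "(\<lambda>n. ln (u n) / real n) \<longlonglongrightarrow> l" and v: "(\<lambda>n. ln (v n) / real n) \<longlonglongrightarrow> l'"
    and u_pos: "\<And>n. 0 < u n" and v_pos: "\<And>n. 0 < v n" and c: "0 < c"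
    and le: "eventually (\<lambda>n. c * u n ^ 2 / real n ^ 2 \<le> v (2 * n + q)) sequentially"
  shows "l \<le> l'"
proof (rule tendsto_le)
  show "(\<lambda>n. ln (v (2 * n + q)) / real (2 * n)) \<longlonglongrightarrow> l'"
    using log_rate_affine[OF v, of 2 2 q 0] by simp
  have "(\<lambda>n. (ln c - 2 * ln (real n)) / real (2 * n)) \<longlonglongrightarrow> 0"
    by real_asymp
  from tendsto_add[OF this u]
  show "(\<lambda>n. (ln c - 2 * ln (real n)) / real (2 * n) + ln (u n) / real n) \<longlonglongrightarrow> l" by simp
  show "eventually (\<lambda>n. (ln c - 2 * ln (real n)) / real (2 * n) + ln (u n) / real n
      \<le> ln (v (2 * n + q)) / real (2 * n)) sequentially"
    using le eventually_gt_at_top[of 0]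
  proof eventually_elim
    case (elim n)
    have "ln (c * u n ^ 2 / real n ^ 2) \<le> ln (v (2 * n + q))"
      using elim c u_pos[of n] by (intro ln_mono) auto
    then have "ln c + 2 * ln (u n) - 2 * ln (real n) \<le> ln (v (2 * n + q))"
      using elim c u_pos[of n] by (simp add: ln_mult ln_div ln_realpow)
    then have "(ln c + 2 * ln (u n) - 2 * ln (real n)) / real (2 * n) \<le> ln (v (2 * n + q)) / real (2 * n)"
      by (intro divide_right_mono) auto
    then show ?case using elim by (simp add: field_simps)
  qed
qed simp

lemma log_rate_sandwich:
  fixes f p :: "nat \<Rightarrow> real"
  assumes f: "(\<lambda>n. ln (f n) / real n) \<longlonglongrightarrow> l" and f_pos: "\<And>n. 0 < f n" and c: "0 < c"
    and lower: "\<And>n. c * f n \<le> p (n + k)" and upper: "\<And>n. c * p n \<le> f (n + k)"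
  shows "(\<lambda>n. ln (p n) / real n) \<longlonglongrightarrow> l" "(\<lambda>n. root n (p n)) \<longlonglongrightarrow> exp l"
proof -
  have p_pos: "0 < p (n + k)" for n
    using lower[of n] c f_pos[of n] by (meson less_le_trans mult_pos_pos)
  have const: "(\<lambda>n. ln c / real (n + k)) \<longlonglongrightarrow> 0" by real_asymp
  have "(\<lambda>n. ln (p (n + k)) / real (n + k)) \<longlonglongrightarrow> l"
  proof (rule tendsto_sandwich)
    show "(\<lambda>n. ln c / real (n + k) + ln (f n) / real (n + k)) \<longlonglongrightarrow> l"
      using tendsto_add[OF const log_rate_affine[OF f, of 1 1 0 k]] by simp
    show "(\<lambda>n. ln (f (n + 2 * k)) / real (n + k) - ln c / real (n + k)) \<longlonglongrightarrow> l"
      using tendsto_diff[OF log_rate_affine[OF f, of 1 1 "2 * k" k] const] by simp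
    have "ln c + ln (f n) \<le> ln (p (n + k))" for n
    proof -
      have "ln (c * f n) \<le> ln (p (n + k))"
        using lower[of n] c f_pos[of n] by (intro ln_mono) auto
      then show ?thesis using c f_pos[of n] by (simp add: ln_mult)
    qed
    then show "eventually (\<lambda>n. ln c / real (n + k) + ln (f n) / real (n + k)
        \<le> ln (p (n + k)) / real (n + k)) sequentially"
      unfolding add_divide_distrib[symmetric] by (intro always_eventually allI divide_right_mono) auto
    have "ln (p (n + k)) \<le> ln (f (n + 2 * k)) - ln c" for n
    proof -
      have "ln (c * p (n + k)) \<le> ln (f (n + 2 * k))"
        using upper[of "n + k"] c p_pos[of n] by (intro ln_mono) (auto simp: mult_2 add.assoc)
      then show ?thesis using c p_pos[of n] by (simp add: ln_mult)
    qed
    then show "eventually (\<lambda>n. ln (p (n + k)) / real (n + k)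
        \<le> ln (f (n + 2 * k)) / real (n + k) - ln c / real (n + k)) sequentially"
      unfolding diff_divide_distrib[symmetric] by (intro always_eventually allI divide_right_mono) auto
  qed
  then show lim: "(\<lambda>n. ln (p n) / real n) \<longlonglongrightarrow> l" by (rule LIMSEQ_offset)
  have "eventually (\<lambda>n. exp (ln (p n) / real n) = root n (p n)) sequentially"
    using eventually_ge_at_top[of "Suc k"]
  proof eventually_elim
    case (elim n)
    then have "0 < p n" using p_pos[of "n - k"] by simp
    then show ?case using elim by (simp add: root_powr_inverse powr_def divide_inverse mult.commute)
  qed
  with tendsto_exp[OF lim] show "(\<lambda>n. root n (p n)) \<longlonglongrightarrow> exp l"
    by (rule Lim_transform_eventually)
qed

section \<open>Almost sure statements and two inequalities\<close>

lemma AE_eventually_le_square: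
  fixes X :: "nat \<Rightarrow> 'a \<Rightarrow> real"
  assumes M: "prob_space M" and meas [measurable]: "\<And>n. X n \<in> borel_measurable M"
    and int: "\<And>n. (\<integral>\<^sup>+x. ennreal (X n x) \<partial>M) \<le> 1"
  shows "AE x in M. eventually (\<lambda>n. X n x \<le> real n ^ 2) sequentially"
proof -
  interpret prob_space M by (rule M)
  define A where "A n = {x\<in>space M. real n ^ 2 < X n x}" for n
  have A [measurable]: "A n \<in> sets M" for n unfolding A_def by measurable
  have bound: "measure M (A n) \<le> 1 / real n ^ 2" if "n \<ge> 1" for n
  proof -
    have "ennreal (real n ^ 2) * emeasure M (A n) = (\<integral>\<^sup>+x. ennreal (real n ^ 2) * indicator (A n) x \<partial>M)"
      by (rule nn_integral_cmult_indicator[symmetric]) measurable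
    also have "\<dots> \<le> (\<integral>\<^sup>+x. ennreal (X n x) \<partial>M)"
      by (intro nn_integral_mono) (auto simp: A_def indicator_def intro!: ennreal_leI)
    also have "\<dots> \<le> 1" by (rule int)
    finally have "ennreal (real n ^ 2 * measure M (A n)) \<le> ennreal 1"
      by (simp add: emeasure_eq_measure ennreal_mult)
    then show ?thesis using that by (simp add: field_simps)
  qed
  have "summable (\<lambda>n. 1 / real n ^ 2)"
    using inverse_power_summable[of 2, where 'a = real] by (simp add: field_simps)
  then have "summable (\<lambda>n. measure M (A n))"
    by (rule summable_comparison_test_ev[rotated])
       (use bound in \<open>auto simp: eventually_sequentially\<close>)
  then have "AE x in M. eventually (\<lambda>n. x \<in> space M - A n) sequentially"
    by (intro borel_cantelli_AE1) (auto simp: emeasure_eq_measure)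
  then show ?thesis
    by eventually_elim (auto simp: A_def not_less elim: eventually_mono)
qed

lemma AE_const_of_zero_one:
  fixes X :: "'a \<Rightarrow> real"
  assumes M: "prob_space M" and [measurable]: "X \<in> borel_measurable M"
    and zero_one: "\<And>t. measure M {x\<in>space M. X x \<le> t} = 0 \<or> measure M {x\<in>space M. X x \<le> t} = 1"
  shows "\<exists>c. AE x in M. X x = c"
proof -
  interpret prob_space M by (rule M)
  let ?F = "\<lambda>t. measure M {x\<in>space M. X x \<le> t}"
  have null: "AE x in M. t < X x" if "?F t = 0" for t
  proof -
    have "AE x in M. \<not> X x \<le> t"
      using that by (subst AE_iff_measurable[OF _ refl]) (auto simp: emeasure_eq_measure)
    then show ?thesis by (simp add: not_le)
  qed
  have full: "AE x in M. X x \<le> t" if "?F t = 1" for t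
    using that by (subst (asm) prob_Collect_eq_1) auto
  define A where "A = {t. ?F t = 1}"
  have nonempty: "A \<noteq> {}"
  proof
    assume "A = {}"
    then have "AE x in M. real n < X x" for n :: nat using null zero_one by (auto simp: A_def)
    then have "AE x in M. \<forall>n::nat. real n < X x" by (simp add: AE_all_countable)
    then have "AE x in M. False"
      by (rule AE_mp) (use reals_Archimedean2 less_asym in blast)
    then show False by simp
  qed
  have up: "t' \<in> A" if "t \<in> A" "t \<le> t'" for t t'
  proof -
    have "?F t \<le> ?F t'" using that by (intro finite_measure_mono) auto
    then show ?thesis using that zero_one[of t'] by (auto simp: A_def)
  qed
  have bdd: "bdd_below A"
  proof (rule ccontr)
    assume unbdd: "\<not> bdd_below A"
    have "t \<in> A" for t
    proof -
      obtain s where "s \<in> A" "s < t" using unbdd by (auto simp: bdd_below_def not_le)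
      then show ?thesis using up by simp
    qed
    then have "AE x in M. X x \<le> - real n" for n :: nat using full by (auto simp: A_def)
    then have "AE x in M. \<forall>n::nat. X x \<le> - real n" by (simp add: AE_all_countable)
    then have "AE x in M. False"
    proof (rule AE_mp, intro AE_I2 impI)
      fix x assume *: "\<forall>n::nat. X x \<le> - real n"
      obtain n :: nat where "- X x < real n" using reals_Archimedean2 by blast
      with *[rule_format, of n] show False by simp
    qed
    then show False by simp
  qed
  define c where "c = Inf A"
  have "AE x in M. X x \<le> c + 1 / real (Suc n)" for n
  proof -
    obtain t where "t \<in> A" "t < c + 1 / real (Suc n)"
      using cInf_lessD[OF nonempty, of "c + 1 / real (Suc n)"] by (auto simp: c_def)
    then show ?thesis using up full by (auto simp: A_def)
  qed
  moreover have "AE x in M. c - 1 / real (Suc n) < X x" for n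
  proof -
    have "c - 1 / real (Suc n) \<notin> A" using cInf_lower[OF _ bdd] by (force simp: c_def)
    then show ?thesis using null zero_one by (auto simp: A_def)
  qed
  ultimately have "AE x in M. \<forall>n. X x \<le> c + 1 / real (Suc n) \<and> c - 1 / real (Suc n) < X x"
    by (simp add: AE_all_countable AE_conj_iff)
  then have "AE x in M. X x = c"
  proof (rule AE_mp, intro AE_I2 impI)
    fix x assume *: "\<forall>n. X x \<le> c + 1 / real (Suc n) \<and> c - 1 / real (Suc n) < X x"
    show "X x = c"
    proof (rule ccontr)
      assume "X x \<noteq> c"
      then obtain n where "1 / real (Suc n) < \<bar>X x - c\<bar>"
        using reals_Archimedean[of "\<bar>X x - c\<bar>"] by (auto simp: inverse_eq_divide)
      with *[rule_format, of n] show False by linarith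
    qed
  qed
  then show ?thesis ..
qed

lemma powr_le_convex_combination:
  fixes t \<theta> :: real
  assumes "0 < t" "0 \<le> \<theta>" "\<theta> \<le> 1"
  shows "t powr \<theta> \<le> \<theta> * t + (1 - \<theta>)"
  using Youngs_inequality_0[of \<theta> "1 - \<theta>" t 1] assms by simp

lemma powr_minus_ge_tangent:
  fixes t s :: real
  assumes "0 < t" "0 < s"
  shows "1 + s - s * t \<le> t powr (- s)"
proof -
  have "ln t \<le> t - 1" using assms ln_le_minus_one by blast
  then have "1 + s - s * t \<le> 1 + - s * ln t" using assms(2) mult_left_mono[of "ln t" "t - 1" s]
    by (simp add: algebra_simps)
  also have "\<dots> \<le> exp (- s * ln t)" by (rule exp_ge_add_one_self)
  finally show ?thesis using assms by (simp add: powr_def)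
qed

section \<open>The law of the lazy random walk\<close>

locale lazy_walk_group = group G for G :: "('g, 'b) monoid_scheme" (structure) +
  fixes S :: "'g set" and a :: real
  assumes finite_S: "finite S" and S_ne: "S \<noteq> {}" and S_carrier: "S \<subseteq> carrier G"
    and S_inv: "s \<in> S \<Longrightarrow> inv s \<in> S"
    and S_gen: "generate G S = carrier G"
    and a_pos: "0 < a" and a_less: "a < 1"
begin

abbreviation W :: "nat \<Rightarrow> 'g pmf" where "W n \<equiv> lazy_walk G S a n"

abbreviation expect :: "nat \<Rightarrow> ('g \<Rightarrow> real) \<Rightarrow> real" where
  "expect n F \<equiv> measure_pmf.expectation (W n) F"

lemma lazy_step_mult:
  assumes "g \<in> carrier G" "h \<in> carrier G"
  shows "lazy_step G S a (g \<otimes> h) = map_pmf (\<lambda>u. g \<otimes> u) (lazy_step G S a h)"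
proof -
  have "map_pmf (\<lambda>s. g \<otimes> h \<otimes> s) (pmf_of_set S) = map_pmf (\<lambda>s. g \<otimes> (h \<otimes> s)) (pmf_of_set S)"
    using assms S_carrier finite_S S_ne by (intro map_pmf_cong refl) (auto simp: m_assoc)
  then show ?thesis
    unfolding lazy_step_def map_bind_pmf
    by (intro bind_pmf_cong refl) (simp add: map_pmf_comp)
qed

lemma set_lazy_step:
  assumes "g \<in> carrier G"
  shows "set_pmf (lazy_step G S a g) = insert g ((\<lambda>s. g \<otimes> s) ` S)"
  using assms a_pos a_less
  by (auto simp: lazy_step_def set_pmf_bernoulli set_pmf_of_set[OF S_ne finite_S] split: if_splits)

lemma set_walk_carrier: "set_pmf (W n) \<subseteq> carrier G"
proof (induction n)
  case (Suc n)
  then show ?case using S_carrier by (auto simp: set_lazy_step subset_iff)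
qed simp

lemma finite_walk: "finite (set_pmf (W n))"
proof (induction n)
  case (Suc n)
  then show ?case
    using set_walk_carrier[of n] finite_S by (auto simp: set_lazy_step subset_iff)
qed simp

lemma expect_sum: "expect n F = (\<Sum>g\<in>set_pmf (W n). F g * pmf (W n) g)"
  by (rule integral_measure_pmf_real[OF finite_walk]) auto

lemma expect_mono:
  assumes "\<And>g. g \<in> set_pmf (W n) \<Longrightarrow> F g \<le> H g"
  shows "expect n F \<le> expect n H"
  unfolding expect_sum using assms by (intro sum_mono mult_right_mono) auto

text \<open>
  The law at time \<open>m + n\<close> is the convolution of the laws at times \<open>m\<close> and \<open>n\<close>. Convolution powers of
  one measure commute, so the two factors may appear in either order.
\<close>

lemma walk_add: "W (m + n) = bind_pmf (W m) (\<lambda>g. map_pmf (\<lambda>h. g \<otimes> h) (W n))"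
proof (induction n)
  case 0
  have "bind_pmf (W m) (\<lambda>g. map_pmf (\<lambda>h. g \<otimes> h) (W 0)) = bind_pmf (W m) return_pmf"
    using set_walk_carrier[of m] by (intro bind_pmf_cong refl) (auto simp: subset_iff)
  then show ?case by (simp add: bind_return_pmf')
next
  case (Suc n)
  have "W (m + Suc n) =
      bind_pmf (W m) (\<lambda>g. bind_pmf (W n) (\<lambda>h. lazy_step G S a (g \<otimes> h)))"
    by (simp add: Suc.IH bind_assoc_pmf bind_map_pmf)
  also have "\<dots> =
      bind_pmf (W m) (\<lambda>g. bind_pmf (W n) (\<lambda>h. map_pmf (\<lambda>u. g \<otimes> u) (lazy_step G S a h)))"
    using set_walk_carrier
    by (intro bind_pmf_cong refl lazy_step_mult) (auto simp: subset_iff)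
  finally show ?case by (simp add: map_bind_pmf)
qed

lemma walk_add': "W (m + n) = bind_pmf (W m) (\<lambda>h. map_pmf (\<lambda>g. g \<otimes> h) (W n))"
  unfolding add.commute[of m n] walk_add[of n m] map_pmf_def
  by (rule bind_commute_pmf)

lemma walk_symmetric: "map_pmf (\<lambda>g. inv g) (W n) = W n"
proof (induction n)
  case (Suc n)
  have one: "map_pmf (\<lambda>g. inv g) (W 1) = W 1"
  proof -
    have "bij_betw (\<lambda>s. inv s) S S"
      by (rule bij_betw_byWitness[where f' = "\<lambda>s. inv s"]) (use S_carrier S_inv in auto)
    then have "map_pmf (\<lambda>s. inv s) (pmf_of_set S) = pmf_of_set S"
      using map_pmf_of_set_bij_betw S_ne finite_S by blast
    moreover have "map_pmf (\<lambda>s. \<one> \<otimes> s) (pmf_of_set S) = map_pmf (\<lambda>s. s) (pmf_of_set S)"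
      using S_carrier finite_S S_ne by (intro map_pmf_cong refl) auto
    ultimately show ?thesis
      by (simp add: bind_return_pmf lazy_step_def map_bind_pmf if_distrib[of "map_pmf _"] 
          map_pmf_ident cong: if_cong)
  qed
  have "map_pmf (\<lambda>g. inv g) (W (n + 1)) =
      bind_pmf (W n) (\<lambda>g. map_pmf (\<lambda>s. inv (g \<otimes> s)) (W 1))"
    unfolding walk_add by (simp only: map_bind_pmf map_pmf_comp)
  also have "\<dots> = bind_pmf (W n) (\<lambda>g. map_pmf (\<lambda>s. inv s \<otimes> inv g) (W 1))"
    using set_walk_carrier[of n] set_walk_carrier[of 1]
    by (intro bind_pmf_cong map_pmf_cong refl inv_mult_group) auto
  also have "\<dots> =
      bind_pmf (map_pmf (\<lambda>g. inv g) (W n))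
        (\<lambda>h. map_pmf (\<lambda>t. t \<otimes> h) (map_pmf (\<lambda>g. inv g) (W 1)))"
    by (simp only: bind_map_pmf map_pmf_comp)
  also have "\<dots> = W (n + 1)"
    unfolding one Suc.IH by (rule walk_add'[symmetric])
  finally show ?case by simp
qed simp

lemma pmf_walk_inv:
  assumes "g \<in> carrier G"
  shows "pmf (W n) (inv g) = pmf (W n) g"
proof -
  have "pmf (W n) (inv g) = pmf (map_pmf (\<lambda>g. inv g) (W n)) (inv g)"
    by (simp only: walk_symmetric)
  also have "\<dots> = measure_pmf.prob (W n) ((\<lambda>g. inv g) -` {inv g})"
    by (simp add: pmf_map)
  also have "\<dots> = measure_pmf.prob (W n) {g}"
    using set_walk_carrier[of n] assms inv_inj
    by (intro measure_pmf.finite_measure_eq_AE) (auto simp: AE_measure_pmf_iff inj_on_def)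
  finally show ?thesis by (simp add: measure_pmf_single)
qed

text \<open>The inner factor \<open>h\<close> acts first, so the walk read from right to left moves a point \<open>x\<close> to \<open>h x\<close>
  in \<open>m\<close> steps and then to \<open>g h x\<close> in \<open>n\<close> more.\<close>

lemma expect_add: "expect (m + n) F = expect m (\<lambda>h. expect n (\<lambda>g. F (g \<otimes> h)))"
  unfolding walk_add'[of m n]
  by (subst pmf_expectation_bind[OF finite_walk]) (auto simp: finite_walk expect_sum mult.commute)

lemma set_walk_mult:
  assumes "h \<in> set_pmf (W m)" "g \<in> set_pmf (W n)"
  shows "g \<otimes> h \<in> set_pmf (W (m + n))"
  using assms by (auto simp: walk_add')

lemma walk_reaches:
  assumes "g \<in> carrier G"
  shows "\<exists>k. g \<in> set_pmf (W k)"
proof -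
  have step: "s \<in> set_pmf (W 1)" if "s \<in> S" for s
    using that S_carrier by (auto simp: set_lazy_step image_iff subset_iff intro!: bexI[of _ s])
  have "g \<in> generate G S" using assms S_gen by simp
  then show ?thesis
  proof induction
    case one
    have "\<one> \<in> set_pmf (W 0)" by simp
    then show ?case by blast
  next
    case (incl h) then show ?case using step by blast
  next
    case (inv h) then show ?case using step S_inv by blast
  next
    case (eng h1 h2) then show ?case using set_walk_mult by blast
  qed
qed

lemma walk_one_ge: "a \<le> pmf (W 1) \<one>"
proof -
  have "a * pmf (return_pmf \<one>) \<one> \<le> pmf (W 1) \<one>"
    using a_pos a_less
    by (simp add: bind_return_pmf lazy_step_def pmf_bind integral_measure_pmf_real[where A=UNIV] UNIV_bool)
  then show ?thesis by simp
qed

end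

section \<open>The walk restricted to the classes of the subrelation\<close>

locale walk_on_subrelation = lazy_walk_group G S a + prob_space M
  for G :: "('g, 'b) monoid_scheme" (structure) and S a and M :: "'a measure" +
  fixes \<phi> :: "'g \<Rightarrow> 'a \<Rightarrow> 'a" and E :: "('a \<times> 'a) set"
  assumes countable_carrier: "countable (carrier G)"
    and pmp: "pmp_action G M \<phi>" and sub: "subrelation M (orbit_relation G M \<phi>) E"
begin

sublocale group_action G "space M" \<phi>
  using pmp by (simp add: pmp_action_def)

lemma E_equiv: "equiv (space M) E"
  using sub by (simp add: subrelation_def)

lemma E_sets [measurable]: "E \<in> sets (M \<Otimes>\<^sub>M M)"
  using sub by (simp add: subrelation_def)

lemma act_measurable [measurable]: "g \<in> carrier G \<Longrightarrow> \<phi> g \<in> measurable M M"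
  using pmp by (simp add: pmp_action_def)

lemma act_distr: "g \<in> carrier G \<Longrightarrow> distr M M (\<phi> g) = M"
  using pmp by (simp add: pmp_action_def)

lemma act_space: "g \<in> carrier G \<Longrightarrow> x \<in> space M \<Longrightarrow> \<phi> g x \<in> space M"
  using element_image by blast

lemma act_one: "x \<in> space M \<Longrightarrow> \<phi> \<one> x = x"
  using id_eq_one by (metis restrict_apply')

lemma act_inv: "g \<in> carrier G \<Longrightarrow> x \<in> space M \<Longrightarrow> \<phi> (inv g) (\<phi> g x) = x"
  using orbit_sym_aux by blast

lemma E_refl: "x \<in> space M \<Longrightarrow> (x, x) \<in> E"
  using E_equiv by (auto simp: equiv_def refl_on_def)

lemma E_sym: "(x, y) \<in> E \<Longrightarrow> (y, x) \<in> E"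
  using E_equiv by (auto simp: equiv_def dest: symD)

lemma E_trans: "(x, y) \<in> E \<Longrightarrow> (y, z) \<in> E \<Longrightarrow> (x, z) \<in> E"
  using E_equiv by (auto simp: equiv_def dest: transD)

lemma E_space: "(x, y) \<in> E \<Longrightarrow> x \<in> space M \<and> y \<in> space M"
  using E_equiv by (auto simp: equiv_def refl_on_def)

lemma E_orbit: "(x, y) \<in> E \<Longrightarrow> \<exists>g\<in>carrier G. y = \<phi> g x"
  using sub by (auto simp: subrelation_def orbit_relation_def)

lemma orbit_relationI: "x \<in> space M \<Longrightarrow> g \<in> carrier G \<Longrightarrow> (x, \<phi> g x) \<in> orbit_relation G M \<phi>"
  by (auto simp: orbit_relation_def)

lemma orbit_relationE:
  assumes "(x, y) \<in> orbit_relation G M \<phi>"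
  obtains g where "x \<in> space M" "g \<in> carrier G" "y = \<phi> g x"
  using assms by (auto simp: orbit_relation_def)

lemma equiv_orbit_relation: "equiv (space M) (orbit_relation G M \<phi>)"
proof (rule equivI)
  show "orbit_relation G M \<phi> \<subseteq> space M \<times> space M"
    using act_space by (auto elim: orbit_relationE)
  show "refl_on (space M) (orbit_relation G M \<phi>)"
  proof (rule refl_onI)
    fix x assume "x \<in> space M"
    then show "(x, x) \<in> orbit_relation G M \<phi>"
      using orbit_relationI[of x \<one>] by (simp add: act_one)
  qed
  show "sym (orbit_relation G M \<phi>)"
  proof (rule symI)
    fix x y assume "(x, y) \<in> orbit_relation G M \<phi>"
    then obtain g where g: "x \<in> space M" "g \<in> carrier G" "y = \<phi> g x" by (rule orbit_relationE)
    then show "(y, x) \<in> orbit_relation G M \<phi>"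
      using orbit_relationI[of y "inv g"] act_space by (simp add: act_inv)
  qed
  show "trans (orbit_relation G M \<phi>)"
  proof (rule transI)
    fix x y z assume "(x, y) \<in> orbit_relation G M \<phi>" "(y, z) \<in> orbit_relation G M \<phi>"
    then obtain g h where g: "x \<in> space M" "g \<in> carrier G" "h \<in> carrier G" "z = \<phi> h (\<phi> g x)"
      by (auto elim!: orbit_relationE)
    then show "(x, z) \<in> orbit_relation G M \<phi>"
      using orbit_relationI[of x "h \<otimes> g"] by (simp add: composition_rule)
  qed
qed

lemma walk_carrier: "g \<in> set_pmf (W n) \<Longrightarrow> g \<in> carrier G"
  using set_walk_carrier by blast

text \<open>
  The averaging operator of the \<open>n\<close>-step walk on the orbits, restricted to steps that end in the
  starting class: \<open>(A\<^sub>n h)(x) = \<Sum>\<^sub>g P(g\<^sub>n = g) h(g x)\<close>, the sum over those \<open>g\<close> with \<open>(x, g x) \<in> E\<close>.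
  The sum is over group elements, so the action need not be free.
\<close>

definition restricted_op :: "nat \<Rightarrow> ('a \<Rightarrow> real) \<Rightarrow> 'a \<Rightarrow> real" where
  "restricted_op n h x = expect n (\<lambda>g. indicator E (x, \<phi> g x) * h (\<phi> g x))"

text \<open>\<open>f\<^sub>n(x) = (A\<^sub>n 1)(x)\<close>, the probability that the walk from \<open>x\<close> is in the class of \<open>x\<close> at time \<open>n\<close>.\<close>

abbreviation return_prob :: "nat \<Rightarrow> 'a \<Rightarrow> real" where
  "return_prob n \<equiv> restricted_op n (\<lambda>_. 1)"

abbreviation hit :: "nat \<Rightarrow> 'a \<Rightarrow> 'a \<Rightarrow> real" where
  "hit \<equiv> hitting_prob G S a \<phi> E"

lemma hit_expect: "hit n x y = expect n (\<lambda>g. indicator E (\<phi> g x, y))"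
proof -
  have "(\<lambda>g. indicator E (\<phi> g x, y)) = (indicator {g. (\<phi> g x, y) \<in> E} :: 'g \<Rightarrow> real)"
    by (auto simp: indicator_def fun_eq_iff)
  then show ?thesis by (simp add: hitting_prob_def)
qed

lemma return_prob_eq_hit: "return_prob n x = hit n x x"
  unfolding restricted_op_def hit_expect
  by (intro arg_cong[where f = "expect n"] ext) (auto simp: indicator_def dest: E_sym)

lemma hit_class_cong: "(y, y') \<in> E \<Longrightarrow> hit n x y = hit n x y'"
  unfolding hit_expect
  by (intro arg_cong[where f = "expect n"] ext) (auto simp: indicator_def dest: E_sym E_trans)

lemma restricted_op_measurable [measurable]:
  assumes [measurable]: "h \<in> borel_measurable M"
  shows "restricted_op n h \<in> borel_measurable M"
proof -
  have "(\<lambda>x. indicator E (x, \<phi> g x) * h (\<phi> g x) * pmf (W n) g) \<in> borel_measurable M"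
    if "g \<in> set_pmf (W n)" for g
  proof -
    have [measurable]: "\<phi> g \<in> measurable M M" using that walk_carrier by simp
    show ?thesis by measurable
  qed
  then show ?thesis
    unfolding restricted_op_def[abs_def] expect_sum by (intro borel_measurable_sum)
qed

lemma restricted_op_nonneg: "(\<And>y. 0 \<le> h y) \<Longrightarrow> 0 \<le> restricted_op n h x"
  unfolding restricted_op_def by (intro Bochner_Integration.integral_nonneg) auto

lemma hit_add_ge:
  assumes "x \<in> space M" "g \<in> carrier G"
  shows "pmf (W k) g * hit n (\<phi> g x) y \<le> hit (k + n) x y"
proof (cases "g \<in> set_pmf (W k)")
  case True
  have "pmf (W k) g * hit n (\<phi> g x) y = (\<Sum>h\<in>{g}. hit n (\<phi> h x) y * pmf (W k) h)"
    by simp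
  also have "\<dots> \<le> (\<Sum>h\<in>set_pmf (W k). hit n (\<phi> h x) y * pmf (W k) h)"
    using True finite_walk by (intro sum_mono2) (auto simp: hitting_prob_def)
  also have "\<dots> = hit (k + n) x y"
    unfolding hit_expect expect_add expect_sum[of k]
    using assms(1) walk_carrier
    by (intro sum.cong arg_cong2[where f = "(*)"] refl) 
       (auto simp: expect_sum composition_rule intro!: sum.cong)
  finally show ?thesis .
next
  case False
  then show ?thesis by (simp add: set_pmf_iff hitting_prob_def)
qed

lemma return_prob_le: "return_prob n x \<le> 1"
  unfolding return_prob_eq_hit hitting_prob_def by simp

lemma return_prob_0: "x \<in> space M \<Longrightarrow> return_prob 0 x = 1"
  by (simp add: restricted_op_def act_one E_refl)

lemma return_prob_Suc: "x \<in> space M \<Longrightarrow> a * return_prob n x \<le> return_prob (Suc n) x"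
proof -
  assume x: "x \<in> space M"
  have "a * hit n x x \<le> pmf (W 1) \<one> * hit n x x"
    using walk_one_ge by (intro mult_right_mono) (auto simp: hitting_prob_def)
  also have "\<dots> \<le> hit (1 + n) x x"
    using hit_add_ge[OF x, of \<one> 1 n x] by (simp add: act_one[OF x])
  finally show ?thesis by (simp add: return_prob_eq_hit)
qed

lemma return_prob_pos: "x \<in> space M \<Longrightarrow> 0 < return_prob n x"
proof (induction n)
  case (Suc n)
  then show ?case using return_prob_Suc[of x n] a_pos by (meson less_le_trans mult_pos_pos)
qed (simp add: return_prob_0)

text \<open>
  The operators form a super-semigroup \<open>A\<^sub>m A\<^sub>n \<le> A\<^bsub>m+n\<^esub>\<close>: a path that is in the class at time \<open>m\<close> and at
  time \<open>m + n\<close> is one of the paths counted on the right.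
\<close>

lemma restricted_op_compose_le:
  assumes "x \<in> space M" and nonneg: "\<And>y. 0 \<le> h y"
  shows "restricted_op m (restricted_op n h) x \<le> restricted_op (m + n) h x"
proof -
  have "indicator E (x, \<phi> g x) * (indicator E (\<phi> g x, \<phi> g' (\<phi> g x)) * h (\<phi> g' (\<phi> g x)))
      \<le> indicator E (x, \<phi> (g' \<otimes> g) x) * h (\<phi> (g' \<otimes> g) x)"
    if "g \<in> set_pmf (W m)" "g' \<in> set_pmf (W n)" for g g'
    using that walk_carrier assms
    by (auto simp: indicator_def composition_rule dest: E_trans)
  then show ?thesis
    unfolding restricted_op_def expect_add
    by (subst Bochner_Integration.integral_mult_right_zero[symmetric]) (intro expect_mono)
qed

text \<open>
  The mass transport principle: \<open>A\<^sub>n\<close> is symmetric with respect to \<open>M\<close>. The summand of \<open>g\<close> on one side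
  becomes that of \<open>g\<inverse>\<close> on the other by the substitution \<open>x \<mapsto> g\<inverse> x\<close>, which preserves \<open>M\<close>, the walk
  gives \<open>g\<close> and \<open>g\<inverse>\<close> the same weight, and \<open>E\<close> is symmetric.
\<close>

lemma restricted_op_self_adjoint:
  assumes [measurable]: "h \<in> borel_measurable M" "k \<in> borel_measurable M"
    and nonneg: "\<And>x. 0 \<le> h x" "\<And>x. 0 \<le> k x"
  shows "(\<integral>\<^sup>+x. ennreal (k x * restricted_op n h x) \<partial>M) = (\<integral>\<^sup>+x. ennreal (h x * restricted_op n k x) \<partial>M)"
proof -
  define I where "I h k g = (\<integral>\<^sup>+x. ennreal (k x * (indicator E (x, \<phi> g x) * h (\<phi> g x))) \<partial>M)"
    for h k :: "'a \<Rightarrow> real" and g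
  have expand: "(\<integral>\<^sup>+x. ennreal (k x * restricted_op n h x) \<partial>M) =
      (\<Sum>g\<in>set_pmf (W n). I h k g * ennreal (pmf (W n) g))"
    if [measurable]: "h \<in> borel_measurable M" "k \<in> borel_measurable M"
      and nonneg: "\<And>x. 0 \<le> h x" "\<And>x. 0 \<le> k x" for h k
  proof -
    have "(\<integral>\<^sup>+x. ennreal (k x * restricted_op n h x) \<partial>M) =
        (\<integral>\<^sup>+x. (\<Sum>g\<in>set_pmf (W n). 
          ennreal (k x * (indicator E (x, \<phi> g x) * h (\<phi> g x))) * ennreal (pmf (W n) g)) \<partial>M)"
      unfolding restricted_op_def expect_sum sum_distrib_left using nonneg
      by (intro nn_integral_cong) (simp add: sum_ennreal ennreal_mult'[symmetric] mult.assoc)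
    also have "\<dots> = (\<Sum>g\<in>set_pmf (W n). (\<integral>\<^sup>+x. 
          ennreal (k x * (indicator E (x, \<phi> g x) * h (\<phi> g x))) * ennreal (pmf (W n) g) \<partial>M))"
    proof (rule nn_integral_sum)
      fix g assume "g \<in> set_pmf (W n)"
      then have [measurable]: "\<phi> g \<in> measurable M M" using walk_carrier by simp
      show "(\<lambda>x. ennreal (k x * (indicator E (x, \<phi> g x) * h (\<phi> g x))) * ennreal (pmf (W n) g))
          \<in> borel_measurable M" by measurable
    qed
    also have "\<dots> = (\<Sum>g\<in>set_pmf (W n). I h k g * ennreal (pmf (W n) g))"
    proof (intro sum.cong refl)
      fix g assume "g \<in> set_pmf (W n)"
      then have [measurable]: "\<phi> g \<in> measurable M M" using walk_carrier by simp
      show "(\<integral>\<^sup>+x. ennreal (k x * (indicator E (x, \<phi> g x) * h (\<phi> g x))) * ennreal (pmf (W n) g) \<partial>M)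
          = I h k g * ennreal (pmf (W n) g)"
        unfolding I_def by (rule nn_integral_multc) measurable
    qed
    finally show ?thesis .
  qed
  have swap: "I h k (inv g) = I k h g" if g: "g \<in> carrier G" for g
  proof -
    have [measurable]: "\<phi> g \<in> measurable M M" "\<phi> (inv g) \<in> measurable M M" using g by auto
    have "I h k (inv g) = (\<integral>\<^sup>+x. ennreal (k x * (indicator E (x, \<phi> (inv g) x) * h (\<phi> (inv g) x))) 
        \<partial>distr M M (\<phi> g))"
      unfolding I_def act_distr[OF g] ..
    also have "\<dots> = (\<integral>\<^sup>+x. ennreal (k (\<phi> g x) * 
        (indicator E (\<phi> g x, \<phi> (inv g) (\<phi> g x)) * h (\<phi> (inv g) (\<phi> g x)))) \<partial>M)"
      by (rule nn_integral_distr) measurable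
    also have "\<dots> = I k h g"
      unfolding I_def using g
      by (intro nn_integral_cong) (auto simp: act_inv indicator_def mult.commute dest: E_sym)
    finally show ?thesis .
  qed
  have "bij_betw (\<lambda>g. inv g) (set_pmf (W n)) (set_pmf (W n))"
  proof (rule bij_betw_byWitness[where f' = "\<lambda>g. inv g"])
    have "(\<lambda>g. inv g) ` set_pmf (W n) = set_pmf (W n)"
      by (simp only: set_map_pmf[symmetric] walk_symmetric)
    then show "(\<lambda>g. inv g) ` set_pmf (W n) \<subseteq> set_pmf (W n)"
      and "(\<lambda>g. inv g) ` set_pmf (W n) \<subseteq> set_pmf (W n)" by simp_all
  qed (use walk_carrier in auto)
  then have "(\<Sum>g\<in>set_pmf (W n). I h k g * ennreal (pmf (W n) g)) =
      (\<Sum>g\<in>set_pmf (W n). I h k (inv g) * ennreal (pmf (W n) (inv g)))"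
    by (rule sum.reindex_bij_betw[symmetric])
  also have "\<dots> = (\<Sum>g\<in>set_pmf (W n). I k h g * ennreal (pmf (W n) g))"
    using walk_carrier by (intro sum.cong refl) (auto simp: swap pmf_walk_inv)
  finally show ?thesis
    using expand[of h k] expand[of k h] nonneg by simp
qed

lemma restricted_op_pos:
  assumes x: "x \<in> space M"
    and pos: "\<And>g. g \<in> set_pmf (W n) \<Longrightarrow> (x, \<phi> g x) \<in> E \<Longrightarrow> 0 < h (\<phi> g x)"
  shows "0 < restricted_op n h x"
proof (rule ccontr)
  assume not_pos: "\<not> 0 < restricted_op n h x"
  define c where "c g = indicator E (x, \<phi> g x) * h (\<phi> g x) * pmf (W n) g" for g
  have c_nonneg: "0 \<le> c g" if "g \<in> set_pmf (W n)" for g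
    using pos[OF that] by (auto simp: c_def indicator_def dest: less_imp_le)
  have "restricted_op n h x = (\<Sum>g\<in>set_pmf (W n). c g)"
    by (simp add: restricted_op_def expect_sum c_def)
  with not_pos c_nonneg have "(\<Sum>g\<in>set_pmf (W n). c g) = 0"
    using sum_nonneg[of "set_pmf (W n)" c] by force
  then have zero: "c g = 0" if "g \<in> set_pmf (W n)" for g
    using that c_nonneg sum_nonneg_eq_0_iff[OF finite_walk, of n c] by simp
  have "indicator E (x, \<phi> g x) * pmf (W n) g = 0" if "g \<in> set_pmf (W n)" for g
    using zero[OF that] pos[OF that] that
    by (auto simp: c_def indicator_def set_pmf_iff split: if_splits)
  then have "return_prob n x = 0"
    unfolding restricted_op_def expect_sum by (intro sum.neutral) auto
  with return_prob_pos[OF x, of n] show False by simp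
qed

text \<open>
  Jensen's inequality for the convex function \<open>t \<mapsto> t\<^bsup>-s\<^esup>\<close> and the probability measure
  \<open>h \<mapsto> (A\<^sub>n h)(x) / f\<^sub>n(x)\<close>, by way of the tangent of this function at the mean.
\<close>

lemma restricted_op_jensen:
  assumes x: "x \<in> space M" and s: "0 < s"
    and pos: "\<And>g. g \<in> set_pmf (W n) \<Longrightarrow> (x, \<phi> g x) \<in> E \<Longrightarrow> 0 < h (\<phi> g x)"
  shows "return_prob n x * (restricted_op n h x / return_prob n x) powr (- s)
      \<le> restricted_op n (\<lambda>y. h y powr (- s)) x"
proof -
  let ?f = "return_prob n x" and ?A = "restricted_op n h x"
  have f: "0 < ?f" using return_prob_pos[OF x] .
  define H where "H = ?A / ?f"
  have "0 < ?A" using x pos by (rule restricted_op_pos)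
  then have H: "0 < H" using f by (simp add: H_def)
  have "?f = (1 + s) * ?f - s / H * ?A" using f H s by (simp add: H_def field_simps)
  also have "\<dots> = expect n (\<lambda>g. indicator E (x, \<phi> g x) * (1 + s - s * (h (\<phi> g x) / H)))"
    unfolding restricted_op_def expect_sum sum_distrib_left sum_subtractf[symmetric]
    by (intro sum.cong refl) (simp add: algebra_simps)
  also have "\<dots> \<le> expect n (\<lambda>g. indicator E (x, \<phi> g x) * (h (\<phi> g x) powr (- s) * H powr s))"
  proof (rule expect_mono)
    fix g assume g: "g \<in> set_pmf (W n)"
    show "indicator E (x, \<phi> g x) * (1 + s - s * (h (\<phi> g x) / H))
        \<le> indicator E (x, \<phi> g x) * (h (\<phi> g x) powr (- s) * H powr s)"
    proof (cases "(x, \<phi> g x) \<in> E")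
      case True
      then have "0 < h (\<phi> g x)" using pos[OF g] by simp
      then have "(h (\<phi> g x) / H) powr (- s) = h (\<phi> g x) powr (- s) * H powr s"
        using H by (simp add: powr_divide powr_minus field_simps)
      moreover have "1 + s - s * (h (\<phi> g x) / H) \<le> (h (\<phi> g x) / H) powr (- s)"
        using powr_minus_ge_tangent[of "h (\<phi> g x) / H" s] \<open>0 < h (\<phi> g x)\<close> H s by simp
      ultimately have "1 + s - s * (h (\<phi> g x) / H) \<le> h (\<phi> g x) powr (- s) * H powr s"
        by simp
      then show ?thesis by (simp add: indicator_def)
    qed simp
  qed
  also have "\<dots> = restricted_op n (\<lambda>y. h y powr (- s)) x * H powr s"
    unfolding restricted_op_def expect_sum sum_distrib_right
    by (intro sum.cong refl) (simp add: mult_ac)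
  finally show ?thesis
    using H unfolding H_def[symmetric] by (simp add: powr_minus field_simps)
qed

section \<open>Almost sure existence of the rate\<close>

text \<open>
  An integrated form of \<open>f\<^sub>n\<^sup>k \<le> f\<^bsub>kn\<^esub>\<close>, valid for every \<open>n\<close> and \<open>k\<close>. Inductively, Jensen's inequality with
  exponent \<open>1/k\<close> bounds \<open>(f\<^sub>n\<^bsup>k+1\<^esup> / f\<^bsub>(k+1)n\<^esub>)\<^bsup>1/k\<^esup>\<close> by \<open>A\<^sub>n(f\<^bsub>kn\<^esub>\<^bsup>-1/k\<^esup>)\<close>, whose integral equals that of
  \<open>f\<^sub>n f\<^bsub>kn\<^esub>\<^bsup>-1/k\<^esup>\<close> by symmetry of \<open>A\<^sub>n\<close>. The exponent is then lowered from \<open>1/k\<close> to \<open>1/(k+1)\<close>, which is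
  possible because \<open>M\<close> has total mass 1.
\<close>

lemma return_prob_ratio_integral_le_1:
  assumes "k \<ge> 1"
  shows "(\<integral>\<^sup>+x. ennreal (return_prob n x * return_prob (k * n) x powr (- 1 / real k)) \<partial>M) \<le> 1"
  using assms
proof (induction k rule: nat_induct_at_least)
  case base
  have "(\<integral>\<^sup>+x. ennreal (return_prob n x * return_prob (1 * n) x powr (- 1 / real 1)) \<partial>M)
      = (\<integral>\<^sup>+x. 1 \<partial>M)"
  proof (rule nn_integral_cong)
    fix x assume "x \<in> space M"
    then have "0 < return_prob n x" by (rule return_prob_pos)
    then show "ennreal (return_prob n x * return_prob (1 * n) x powr (- 1 / real 1)) = 1"
      by (simp add: powr_minus)
  qed
  then show ?case by (simp add: emeasure_space_1)
next
  case (Suc k)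
  define \<theta> where "\<theta> = real k / real (Suc k)"
  define h where "h = (\<lambda>y. return_prob (k * n) y powr (- 1 / real k))"
  have \<theta>: "0 \<le> \<theta>" "\<theta> \<le> 1" by (auto simp: \<theta>_def)
  have [measurable]: "h \<in> borel_measurable M" unfolding h_def by measurable
  have h_nonneg: "0 \<le> h y" for y by (simp add: h_def)
  have pointwise: "return_prob n x * return_prob (Suc k * n) x powr (- 1 / real (Suc k))
      \<le> \<theta> * restricted_op n h x + (1 - \<theta>)" if x: "x \<in> space M" for x
  proof -
    define F where "F = return_prob n x"
    define H where "H = return_prob (Suc k * n) x"
    define A where "A = restricted_op n (return_prob (k * n)) x"
    \<comment> \<open>\<open>t = (F\<^bsup>k+1\<^esup> / H)\<^bsup>1/k\<^esup>\<close>, and \<open>t\<^sup>\<theta>\<close> is the quantity to be bounded.\<close>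
    define t where "t = F * (H / F) powr (- (1 / real k))"
    have F: "0 < F" and H: "0 < H" using return_prob_pos[OF x] by (auto simp: F_def H_def)
    have pos: "0 < return_prob (k * n) (\<phi> g x)" if "g \<in> set_pmf (W n)" for g
      using that walk_carrier x act_space return_prob_pos by blast
    have A: "0 < A" unfolding A_def using x pos by (rule restricted_op_pos)
    have "A \<le> H"
      unfolding A_def H_def using restricted_op_compose_le[OF x, of "\<lambda>_. 1" n "k * n"] by simp
    then have "A / F \<le> H / F" using F by (intro divide_right_mono) auto
    then have "(H / F) powr (- (1 / real k)) \<le> (A / F) powr (- (1 / real k))"
      using A F by (intro powr_mono2') auto
    then have "t \<le> F * (A / F) powr (- (1 / real k))"
      unfolding t_def using F by (intro mult_left_mono) auto
    also have "\<dots> \<le> restricted_op n h x"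
      using restricted_op_jensen[OF x, of "1 / real k" n "return_prob (k * n)"] pos Suc.hyps
      by (simp add: F_def A_def h_def)
    finally have t_le: "t \<le> restricted_op n h x" .
    have "F * H powr (- 1 / real (Suc k)) = t powr \<theta>"
    proof -
      have "- (1 / real k) * \<theta> = - 1 / real (Suc k)" using Suc.hyps by (simp add: \<theta>_def)
      then have "t powr \<theta> = F powr \<theta> * (H / F) powr (- 1 / real (Suc k))"
        using F H by (simp add: t_def powr_mult powr_powr)
      also have "\<dots> = (F powr \<theta> * F powr (1 / real (Suc k))) * H powr (- 1 / real (Suc k))"
        using F H by (simp add: powr_divide powr_minus field_simps)
      also have "F powr \<theta> * F powr (1 / real (Suc k)) = F"
        using F by (simp add: powr_add[symmetric] \<theta>_def add_divide_distrib[symmetric] add.commute)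
      finally show ?thesis by simp
    qed
    also have "\<dots> \<le> \<theta> * t + (1 - \<theta>)"
      using F H \<theta> by (intro powr_le_convex_combination) (auto simp: t_def)
    also have "\<dots> \<le> \<theta> * restricted_op n h x + (1 - \<theta>)"
      using t_le \<theta> by (intro add_right_mono mult_left_mono) auto
    finally show ?thesis by (simp only: F_def H_def)
  qed
  have "(\<integral>\<^sup>+x. ennreal (1 * restricted_op n h x) \<partial>M) = (\<integral>\<^sup>+x. ennreal (h x * return_prob n x) \<partial>M)"
    by (rule restricted_op_self_adjoint) (auto simp: h_nonneg)
  also have "\<dots> \<le> 1" using Suc.IH by (simp add: h_def mult.commute)
  finally have int: "(\<integral>\<^sup>+x. ennreal (restricted_op n h x) \<partial>M) \<le> 1" by simp
  have "(\<integral>\<^sup>+x. ennreal (return_prob n x * return_prob (Suc k * n) x powr (- 1 / real (Suc k))) \<partial>M)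
      \<le> (\<integral>\<^sup>+x. ennreal \<theta> * ennreal (restricted_op n h x) + ennreal (1 - \<theta>) \<partial>M)"
  proof (rule nn_integral_mono)
    fix x assume x: "x \<in> space M"
    have "ennreal \<theta> * ennreal (restricted_op n h x) + ennreal (1 - \<theta>)
        = ennreal (\<theta> * restricted_op n h x + (1 - \<theta>))"
      using \<theta> restricted_op_nonneg[of h n x, OF h_nonneg]
      by (simp add: ennreal_mult[symmetric] ennreal_plus[symmetric] del: ennreal_plus)
    then show "ennreal (return_prob n x * return_prob (Suc k * n) x powr (- 1 / real (Suc k)))
        \<le> ennreal \<theta> * ennreal (restricted_op n h x) + ennreal (1 - \<theta>)"
      using pointwise[OF x] by (simp add: ennreal_leI)
  qed
  also have "\<dots> = ennreal \<theta> * (\<integral>\<^sup>+x. ennreal (restricted_op n h x) \<partial>M) + ennreal (1 - \<theta>)"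
    by (simp add: nn_integral_add nn_integral_cmult emeasure_space_1)
  also have "\<dots> \<le> ennreal \<theta> * 1 + ennreal (1 - \<theta>)"
    using int by (intro add_right_mono mult_left_mono) auto
  also have "\<dots> = 1" using \<theta> by (simp add: ennreal_plus[symmetric] del: ennreal_plus)
  finally show ?case .
qed

text \<open>The exponential rate at which the walk returns to its class, on the logarithmic scale: the
  co-spectral radius is \<open>exp l\<close>. At \<open>n = 0\<close> the quotient is \<open>0\<close>.\<close>

definition has_rate :: "'a \<Rightarrow> real \<Rightarrow> bool" where
  "has_rate y l \<longleftrightarrow> (\<lambda>n. ln (return_prob n y) / real n) \<longlonglongrightarrow> l"

lemma AE_has_rate: "AE y in M. \<exists>l. has_rate y l"
proof -
  have "AE y in M. \<forall>k. k \<ge> 1 \<longrightarrow> eventually (\<lambda>n.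
      return_prob n y * return_prob (k * n) y powr (- 1 / real k) \<le> real n ^ 2) sequentially"
    unfolding AE_all_countable
  proof
    fix k
    show "AE y in M. k \<ge> 1 \<longrightarrow> eventually (\<lambda>n.
        return_prob n y * return_prob (k * n) y powr (- 1 / real k) \<le> real n ^ 2) sequentially"
      using AE_eventually_le_square[OF prob_space_axioms, 
          of "\<lambda>n y. return_prob n y * return_prob (k * n) y powr (- 1 / real k)"]
        return_prob_ratio_integral_le_1[of k]
      by (cases "k \<ge> 1") auto
  qed
  then show ?thesis
  proof (rule AE_mp, intro AE_I2 impI)
    fix y assume y: "y \<in> space M" and "\<forall>k. k \<ge> 1 \<longrightarrow> eventually (\<lambda>n.
        return_prob n y * return_prob (k * n) y powr (- 1 / real k) \<le> real n ^ 2) sequentially"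
    then show "\<exists>l. has_rate y l"
      unfolding has_rate_def using return_prob_pos[OF y] return_prob_le return_prob_Suc[OF y]
      by (intro log_rate_exists[where c = a]) (auto simp: a_pos return_prob_0)
  qed
qed

text \<open>
  Starting the walk elsewhere in the orbit of \<open>y\<close> changes the probability of being in the class of \<open>y\<close>
  only by a constant factor and a bounded time shift.
\<close>

lemma hit_rate:
  assumes y: "y \<in> space M" and g: "g \<in> carrier G" and rate: "has_rate y l"
  shows "(\<lambda>n. ln (hit n (\<phi> g y) y) / real n) \<longlonglongrightarrow> l" "(\<lambda>n. root n (hit n (\<phi> g y) y)) \<longlonglongrightarrow> exp l"
proof -
  obtain k where k: "g \<in> set_pmf (W k)" using walk_reaches[OF g] by blast
  define c where "c = pmf (W k) g"
  have c: "0 < c" using k by (simp add: c_def pmf_positive)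
  have lower: "c * return_prob n y \<le> hit (n + k) (\<phi> g y) y" for n
    using hit_add_ge[OF act_space[OF g y], of "inv g" k n y] g y
    by (simp add: act_inv pmf_walk_inv c_def return_prob_eq_hit add.commute)
  have upper: "c * hit n (\<phi> g y) y \<le> return_prob (n + k) y" for n
    using hit_add_ge[OF y g, of k n y] by (simp add: c_def return_prob_eq_hit add.commute)
  show "(\<lambda>n. ln (hit n (\<phi> g y) y) / real n) \<longlonglongrightarrow> l" "(\<lambda>n. root n (hit n (\<phi> g y) y)) \<longlonglongrightarrow> exp l"
    using log_rate_sandwich[OF rate[unfolded has_rate_def] return_prob_pos[OF y] c lower upper]
    by blast+
qed

lemma has_rate_class:
  assumes "(y, y') \<in> E" "has_rate y l"
  shows "has_rate y' l"
proof -
  obtain g where g: "g \<in> carrier G" "y' = \<phi> g y" using E_orbit assms(1) by blast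
  have "(\<lambda>n. ln (hit n y' y) / real n) \<longlonglongrightarrow> l"
    using hit_rate(1)[OF _ g(1) assms(2)] E_space[OF assms(1)] g(2) by simp
  then show ?thesis
    using hit_class_cong[OF assms(1)] by (simp add: has_rate_def return_prob_eq_hit)
qed

section \<open>Comparing the rates of different classes in one orbit\<close>

lemma restricted_op_indicator_pos:
  assumes "x \<in> Z" "x \<in> space M" "g \<in> set_pmf (W n)" "(x, \<phi> g x) \<in> E"
  shows "0 < restricted_op n (indicator Z) (\<phi> g x)"
proof -
  have g: "g \<in> carrier G" using assms walk_carrier by blast
  have g': "inv g \<in> set_pmf (W n)"
    using assms(3) pmf_walk_inv[OF g] by (simp add: set_pmf_iff)
  let ?t = "\<lambda>h. indicator E (\<phi> g x, \<phi> h (\<phi> g x)) * indicator Z (\<phi> h (\<phi> g x)) * pmf (W n) h :: real"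
  have "0 < ?t (inv g)"
    using assms g g' E_sym by (auto simp: act_inv set_pmf_iff pmf_pos)
  also have "\<dots> \<le> (\<Sum>h\<in>set_pmf (W n). ?t h)"
    using g' finite_walk by (intro member_le_sum) auto
  finally show ?thesis by (simp add: restricted_op_def expect_sum)
qed

lemma restricted_op_indicator_pos_double:
  assumes "x \<in> Z" "x \<in> space M"
  shows "0 < restricted_op (n + n) (indicator Z) x"
proof -
  have "0 < restricted_op n (restricted_op n (indicator Z)) x"
    using assms(2) restricted_op_indicator_pos[OF assms] by (rule restricted_op_pos)
  also have "\<dots> \<le> restricted_op (n + n) (indicator Z) x"
    using assms by (intro restricted_op_compose_le) auto
  finally show ?thesis .
qed

text \<open>
  Restricting the target from the class of \<open>x\<close> to its intersection with \<open>Z\<close>. With \<open>q = A\<^sub>n 1\<^sub>Z\<close>, Jensen's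
  inequality gives \<open>f\<^sub>n\<^sup>2 / A\<^sub>n q \<le> A\<^sub>n(1/q)\<close> on \<open>Z\<close>, and \<open>\<integral>\<^sub>Z A\<^sub>n(1/q) = \<integral> (1/q) A\<^sub>n 1\<^sub>Z \<le> 1\<close>. Off \<open>{q > 0}\<close> the
  function \<open>1/q\<close> is read as \<open>0\<close>, which is harmless since \<open>q > 0\<close> wherever the walk can lead from \<open>Z\<close>.
\<close>

lemma return_to_subset_integral_le_1:
  assumes [measurable]: "Z \<in> sets M"
  shows "(\<integral>\<^sup>+x. ennreal (indicator Z x * (return_prob n x ^ 2 / restricted_op (n + n) (indicator Z) x)) \<partial>M)
      \<le> 1"
proof -
  define q where "q = restricted_op n (indicator Z)"
  define h where "h = (\<lambda>y. q y powr (- 1))"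
  have q_nonneg: "0 \<le> q y" for y by (simp add: q_def restricted_op_nonneg)
  have [measurable]: "q \<in> borel_measurable M" "h \<in> borel_measurable M"
    unfolding h_def q_def by measurable
  have pointwise: "indicator Z x * (return_prob n x ^ 2 / restricted_op (n + n) (indicator Z) x)
      \<le> indicator Z x * restricted_op n h x" if x: "x \<in> space M" for x
  proof (cases "x \<in> Z")
    case True
    define F where "F = return_prob n x"
    have F: "0 < F" using return_prob_pos[OF x] by (simp add: F_def)
    have pos: "0 < q (\<phi> g x)" if "g \<in> set_pmf (W n)" "(x, \<phi> g x) \<in> E" for g
      using restricted_op_indicator_pos[OF True x that] by (simp add: q_def)
    have Q: "0 < restricted_op n q x" using x pos by (rule restricted_op_pos)
    have "F ^ 2 / restricted_op (n + n) (indicator Z) x \<le> F ^ 2 / restricted_op n q x"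
      using Q F restricted_op_compose_le[OF x, of "indicator Z" n n]
      by (intro divide_left_mono) (auto simp: q_def intro!: mult_pos_pos)
    also have "\<dots> = F * (restricted_op n q x / F) powr (- 1)"
      using F Q by (simp add: powr_minus power2_eq_square)
    also have "\<dots> \<le> restricted_op n h x"
      using restricted_op_jensen[OF x, of 1 n q] pos by (simp add: F_def h_def)
    finally show ?thesis by (simp add: F_def True)
  qed simp
  have "(\<integral>\<^sup>+x. ennreal (indicator Z x * (return_prob n x ^ 2 / restricted_op (n + n) (indicator Z) x)) \<partial>M)
      \<le> (\<integral>\<^sup>+x. ennreal (indicator Z x * restricted_op n h x) \<partial>M)"
    using pointwise by (intro nn_integral_mono ennreal_leI)
  also have "\<dots> = (\<integral>\<^sup>+x. ennreal (h x * q x) \<partial>M)"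
    unfolding q_def by (rule restricted_op_self_adjoint) (auto simp: h_def)
  also have "\<dots> \<le> (\<integral>\<^sup>+x. 1 \<partial>M)"
  proof (rule nn_integral_mono)
    fix x
    show "ennreal (h x * q x) \<le> 1"
      using q_nonneg[of x] by (cases "q x = 0") (auto simp: h_def powr_minus)
  qed
  finally show ?thesis by (simp add: emeasure_space_1)
qed

text \<open>
  If the translation by \<open>g\<close> maps the part of the class of \<open>y\<close> in \<open>Z\<close> into the class of \<open>g y\<close>, then walks
  from \<open>y\<close> to that part become walks from \<open>g y\<close> to its own class when they are preceded by a path from
  \<open>g y\<close> to \<open>y\<close> and followed by the translation.
\<close>

lemma rate_translate_le:
  assumes y: "y \<in> space M" "y \<in> Z" and g: "g \<in> carrier G"
    and map: "\<And>z. (y, z) \<in> E \<Longrightarrow> z \<in> Z \<Longrightarrow> (\<phi> g z, \<phi> g y) \<in> E"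
    and ev: "eventually (\<lambda>n. return_prob n y ^ 2 / restricted_op (n + n) (indicator Z) y \<le> real n ^ 2)
      sequentially"
    and rates: "has_rate y l" "has_rate (\<phi> g y) l'"
  shows "l \<le> l'"
proof -
  obtain k where k: "g \<in> set_pmf (W k)" using walk_reaches[OF g] by blast
  define c where "c = pmf (W k) g"
  have c: "0 < c" using k by (simp add: c_def pmf_positive)
  note gy = act_space[OF g y(1)]
  have translate: "c ^ 2 * restricted_op (n + n) (indicator Z) y \<le> return_prob (2 * n + 2 * k) (\<phi> g y)" for n
  proof -
    have "c * restricted_op (n + n) (indicator Z) y
        \<le> expect (n + n) (\<lambda>h. c * indicator E (\<phi> g (\<phi> h y), \<phi> g y))"
      unfolding restricted_op_def Bochner_Integration.integral_mult_right_zero[symmetric]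
      using map c by (intro expect_mono mult_left_mono) (auto simp: indicator_def)
    also have "\<dots> \<le> expect (n + n) (\<lambda>h. expect k (\<lambda>u. indicator E (\<phi> (u \<otimes> h) y, \<phi> g y)))"
    proof (rule expect_mono)
      fix h assume "h \<in> set_pmf (W (n + n))"
      then have h: "h \<in> carrier G" using walk_carrier by blast
      let ?t = "\<lambda>u. indicator E (\<phi> (u \<otimes> h) y, \<phi> g y) * pmf (W k) u :: real"
      have "c * indicator E (\<phi> g (\<phi> h y), \<phi> g y) = ?t g"
        by (simp add: composition_rule[OF y(1) g h] c_def)
      also have "\<dots> \<le> (\<Sum>u\<in>set_pmf (W k). ?t u)"
        using k finite_walk by (intro member_le_sum) auto
      finally show "c * indicator E (\<phi> g (\<phi> h y), \<phi> g y)
          \<le> expect k (\<lambda>u. indicator E (\<phi> (u \<otimes> h) y, \<phi> g y))"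
        by (simp add: expect_sum)
    qed
    also have "\<dots> = hit (n + n + k) y (\<phi> g y)" by (simp add: hit_expect expect_add)
    finally have "c * (c * restricted_op (n + n) (indicator Z) y) \<le> c * hit (n + n + k) y (\<phi> g y)"
      using c by (intro mult_left_mono) auto
    also have "\<dots> \<le> hit (k + (n + n + k)) (\<phi> g y) (\<phi> g y)"
      using hit_add_ge[OF gy, of "inv g" k "n + n + k" "\<phi> g y"] g y
      by (simp add: act_inv pmf_walk_inv c_def)
    also have "k + (n + n + k) = 2 * n + 2 * k" by simp
    finally show ?thesis by (simp add: power2_eq_square return_prob_eq_hit mult.assoc)
  qed
  show ?thesis
  proof (rule log_rate_mono[OF rates[unfolded has_rate_def]])
    show "eventually (\<lambda>n. c ^ 2 * return_prob n y ^ 2 / real n ^ 2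
        \<le> return_prob (2 * n + 2 * k) (\<phi> g y)) sequentially"
      using ev eventually_gt_at_top[of 0]
    proof eventually_elim
      case (elim n)
      then have "return_prob n y ^ 2 / real n ^ 2 \<le> restricted_op (n + n) (indicator Z) y"
        using restricted_op_indicator_pos_double[OF y(2,1), of n] by (simp add: field_simps)
      then have "c ^ 2 * (return_prob n y ^ 2 / real n ^ 2) \<le> c ^ 2 * restricted_op (n + n) (indicator Z) y"
        by (intro mult_left_mono) auto
      with translate[of n] show ?case by simp
    qed
  qed (use c return_prob_pos y gy in auto)
qed

text \<open>
  On the set \<open>Z g\<close> of all \<open>z\<close> for which \<open>F z\<close> and \<open>g z\<close> are in the same class, \<open>F\<close> acts on classes like
  the translation by \<open>g\<close>. These countably many sets cover almost all of the space.
\<close>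

lemma AE_rate_le_endomorphism:
  assumes F: "F \<in> End_rel M (orbit_relation G M \<phi>) E"
  shows "AE y in M. \<forall>l l'. has_rate y l \<longrightarrow> has_rate (F y) l' \<longrightarrow> l \<le> l'"
proof -
  define Z where "Z g = {z \<in> space M. (F z, \<phi> g z) \<in> E}" for g
  have F_meas [measurable]: "F \<in> measurable M M"
    and F_AE: "AE y in M. F y \<in> orbit_relation G M \<phi> `` {y} \<and> F ` (E `` {y}) \<subseteq> E `` {F y}"
    using F by (auto simp: End_rel_def)
  have Z: "Z g \<in> sets M" if "g \<in> carrier G" for g
  proof -
    have [measurable]: "\<phi> g \<in> measurable M M" using that by simp
    show ?thesis unfolding Z_def by measurable
  qed
  have "AE y in M. \<forall>g\<in>carrier G. eventually (\<lambda>n. indicator (Z g) y *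
      (return_prob n y ^ 2 / restricted_op (n + n) (indicator (Z g)) y) \<le> real n ^ 2) sequentially"
    unfolding AE_ball_countable[OF countable_carrier]
  proof
    fix g assume "g \<in> carrier G"
    then have [measurable]: "Z g \<in> sets M" by (rule Z)
    show "AE y in M. eventually (\<lambda>n. indicator (Z g) y *
        (return_prob n y ^ 2 / restricted_op (n + n) (indicator (Z g)) y) \<le> real n ^ 2) sequentially"
      by (rule AE_eventually_le_square[OF prob_space_axioms _ return_to_subset_integral_le_1]) measurable
  qed
  then show ?thesis
    using F_AE AE_space
  proof eventually_elim
    case (elim y)
    show ?case
    proof (intro allI impI)
      fix l l' assume rates: "has_rate y l" "has_rate (F y) l'"
      obtain g where g: "g \<in> carrier G" "F y = \<phi> g y"
        using elim(2) by (auto simp: orbit_relation_def)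
      have yZ: "y \<in> Z g" using elim(3) g act_space E_refl by (auto simp: Z_def)
      show "l \<le> l'"
      proof (rule rate_translate_le[OF elim(3) yZ g(1)])
        fix z assume z: "(y, z) \<in> E" "z \<in> Z g"
        then have "(F y, F z) \<in> E" using elim(2) by auto
        moreover have "(F z, \<phi> g z) \<in> E" using z by (simp add: Z_def)
        ultimately show "(\<phi> g z, \<phi> g y) \<in> E" using E_trans E_sym g(2) by metis
      next
        show "eventually (\<lambda>n. return_prob n y ^ 2 / restricted_op (n + n) (indicator (Z g)) y
            \<le> real n ^ 2) sequentially"
          using elim(1) g(1) yZ by auto
      qed (use rates g(2) in auto)
    qed
  qed
qed

lemma AE_act: 
  assumes "AE y in M. P y" "g \<in> carrier G"
  shows "AE y in M. P (\<phi> g y)"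
proof (rule AE_distrD[OF act_measurable[OF assms(2)]])
  show "AE y in distr M M (\<phi> g). P y" unfolding act_distr[OF assms(2)] by (rule assms(1))
qed

lemma AE_rate_orbit_invariant:
  assumes "normal_subrelation M (orbit_relation G M \<phi>) E"
  shows "AE y in M. \<exists>l. \<forall>g\<in>carrier G. has_rate (\<phi> g y) l"
proof -
  let ?R = "orbit_relation G M \<phi>"
  obtain D where D: "D \<subseteq> End_rel M ?R E" "countable D"
      and cover: "AE y in M. ?R `` {y} = (\<Union>f\<in>D. f ` (E `` {y}))"
    using assms by (auto simp: normal_subrelation_def)
  have "AE y in M. \<forall>f\<in>D. \<forall>l l'. has_rate y l \<longrightarrow> has_rate (f y) l' \<longrightarrow> l \<le> l'"
    unfolding AE_ball_countable[OF D(2)] using D(1) AE_rate_le_endomorphism by blast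
  with cover AE_has_rate AE_space
  have "AE y in M. ?R `` {y} = (\<Union>f\<in>D. f ` (E `` {y})) \<and> (\<exists>l. has_rate y l) \<and>
      (\<forall>f\<in>D. \<forall>l l'. has_rate y l \<longrightarrow> has_rate (f y) l' \<longrightarrow> l \<le> l')"
    (is "AE y in M. ?good y") by eventually_elim blast
  then have "AE y in M. \<forall>g\<in>carrier G. ?good (\<phi> g y)"
    unfolding AE_ball_countable[OF countable_carrier] using AE_act[of ?good] by blast
  then show ?thesis
    using AE_space
  proof eventually_elim
    case (elim y)
    note good = elim(1)[rule_format]
    have mono: "l \<le> l'"
      if g: "g \<in> carrier G" and h: "h \<in> carrier G"
        and rates: "has_rate (\<phi> g y) l" "has_rate (\<phi> h y) l'" for g h l l'
    proof -
      have "\<phi> h y = \<phi> (h \<otimes> inv g) (\<phi> g y)"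
        using g h elim(2) composition_rule[OF act_space[OF g elim(2)], of h "inv g"] by (simp add: act_inv)
      then have "\<phi> h y \<in> ?R `` {\<phi> g y}"
        using g h elim(2) act_space by (auto simp: orbit_relation_def)
      then have "\<phi> h y \<in> (\<Union>f\<in>D. f ` (E `` {\<phi> g y}))" using good[OF g] by blast
      then obtain f z where f: "f \<in> D" "\<phi> h y = f z" "(\<phi> g y, z) \<in> E" by auto
      obtain u where u: "u \<in> carrier G" "z = \<phi> u (\<phi> g y)" using E_orbit f(3) by blast
      then have z: "z = \<phi> (u \<otimes> g) y" using composition_rule[OF elim(2) u(1) g] by simp
      have "has_rate z l" using has_rate_class f(3) rates(1) by blast
      then show ?thesis
        using good[of "u \<otimes> g"] u(1) g f(1,2) rates(2) z by auto
    qed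
    obtain l where l: "has_rate (\<phi> \<one> y) l" using good[of \<one>] by blast
    have "has_rate (\<phi> g y) l" if g: "g \<in> carrier G" for g
    proof -
      obtain l' where l': "has_rate (\<phi> g y) l'" using good[OF g] by blast
      have "l = l'" using mono[OF _ g l l'] mono[OF g _ l' l] by (intro antisym) auto
      with l' show ?thesis by simp
    qed
    then show ?case by blast
  qed
qed

section \<open>Constancy under ergodicity\<close>

text \<open>
  The predicate \<open>P\<close> is a version of \<^const>\<open>has_rate\<close> that is exactly invariant under \<open>Q\<close>, not merely
  almost everywhere, so that its level sets are unions of classes.
\<close>

lemma rate_const_of_ergodic:
  assumes ergodic: "ergodic_relation M Q" and Q: "equiv (space M) Q"
    and ex: "AE y in M. \<exists>l. P y l" and P: "\<And>y l. P y l \<Longrightarrow> has_rate y l"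
    and invariant: "\<And>y y' l. (y, y') \<in> Q \<Longrightarrow> P y l \<Longrightarrow> P y' l"
  shows "\<exists>c. AE y in M. has_rate y c"
proof -
  define \<sigma> where "\<sigma> y = lim (\<lambda>n. ln (return_prob n y) / real n)" for y
  have [measurable]: "\<sigma> \<in> borel_measurable M" unfolding \<sigma>_def by measurable
  have \<sigma>: "\<sigma> y = l" if "P y l" for y l
    using P[OF that] unfolding \<sigma>_def has_rate_def by (rule limI)
  have zero_one: "prob {y \<in> space M. \<sigma> y \<le> t} = 0 \<or> prob {y \<in> space M. \<sigma> y \<le> t} = 1" for t
  proof -
    define B where "B = {y \<in> space M. \<exists>l\<le>t. P y l}"
    have "Q `` B = B"
      using Q invariant by (fastforce simp: B_def equiv_def refl_on_def)
    moreover have "AE y in M. y \<in> {y \<in> space M. \<sigma> y \<le> t} \<longleftrightarrow> y \<in> B"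
      using ex AE_space by eventually_elim (auto simp: B_def dest: \<sigma>)
    moreover have "{y \<in> space M. \<sigma> y \<le> t} \<in> sets M" by measurable
    moreover have "B \<subseteq> space M" by (auto simp: B_def)
    ultimately show ?thesis using ergodic unfolding ergodic_relation_def by blast
  qed
  obtain c where c: "AE y in M. \<sigma> y = c" using AE_const_of_zero_one[OF prob_space_axioms _ zero_one] by auto
  have "AE y in M. has_rate y c"
    using ex c by eventually_elim (use \<sigma> P in blast)
  then show ?thesis by blast
qed

end


section \<open>Existence, independence of the base point, and constancy of the co-spectral radius\<close>

theorem theorem1p2:
  fixes \<Gamma> :: "('g, 'b) monoid_scheme" and S :: "'g set"
    and \<mu> :: "'a measure" and \<phi> :: "'g \<Rightarrow> 'a \<Rightarrow> 'a"
    and \<R> \<S> :: "('a \<times> 'a) set" and a :: real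
  assumes "group \<Gamma>" "infinite (carrier \<Gamma>)" "countable (carrier \<Gamma>)"
    and "finite S" "S \<subseteq> carrier \<Gamma>" "\<And>s. s \<in> S \<Longrightarrow> inv\<^bsub>\<Gamma>\<^esub> s \<in> S"
    and "generate \<Gamma> S = carrier \<Gamma>"
    and "prob_space \<mu>" "standard_borel \<mu>"
    and "pmp_action \<Gamma> \<mu> \<phi>"
    and "\<R> = orbit_relation \<Gamma> \<mu> \<phi>"
    and "subrelation \<mu> \<R> \<S>"
    and "0 < a" "a < 1"
  shows "(AE y in \<mu>.
            (\<forall>x\<in>orbit \<Gamma> \<phi> y. convergent (\<lambda>n. root n (hitting_prob \<Gamma> S a \<phi> \<S> n x y))) \<and>
            (\<forall>x\<in>orbit \<Gamma> \<phi> y. \<forall>x'\<in>orbit \<Gamma> \<phi> y.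
               cospectral_radius \<Gamma> S a \<phi> \<S> x y = cospectral_radius \<Gamma> S a \<phi> \<S> x' y)) \<and>
         (ergodic_relation \<mu> \<S> \<or> (normal_subrelation \<mu> \<R> \<S> \<and> ergodic_relation \<mu> \<R>) \<longrightarrow>
            (\<exists>c. AE y in \<mu>. \<forall>x\<in>orbit \<Gamma> \<phi> y. cospectral_radius \<Gamma> S a \<phi> \<S> x y = c))"
proof -
  interpret \<Gamma>: group \<Gamma> by (rule assms(1))
  have "S \<noteq> {}"
  proof
    assume "S = {}"
    then have "carrier \<Gamma> = {\<one>\<^bsub>\<Gamma>\<^esub>}" using assms(7) \<Gamma>.generate_empty by simp
    with assms(2) show False by simp
  qed
  interpret prob_space \<mu> by (rule assms(8))
  interpret walk_on_subrelation \<Gamma> S a \<mu> \<phi> \<S>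
    by unfold_locales (use assms \<open>S \<noteq> {}\<close> in auto)
  have limit: "(\<lambda>n. root n (hit n x y)) \<longlonglongrightarrow> exp l"
    if "y \<in> space \<mu>" "has_rate y l" "x \<in> orbit \<Gamma> \<phi> y" for x y l
    using that hit_rate(2) by (auto simp: orbit_def)
  have radius: "cospectral_radius \<Gamma> S a \<phi> \<S> x y = exp l"
    if "y \<in> space \<mu>" "has_rate y l" "x \<in> orbit \<Gamma> \<phi> y" for x y l
    using limit[OF that] unfolding cospectral_radius_def by (rule limI)
  have "AE y in \<mu>.
      (\<forall>x\<in>orbit \<Gamma> \<phi> y. convergent (\<lambda>n. root n (hit n x y))) \<and>
      (\<forall>x\<in>orbit \<Gamma> \<phi> y. \<forall>x'\<in>orbit \<Gamma> \<phi> y.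
        cospectral_radius \<Gamma> S a \<phi> \<S> x y = cospectral_radius \<Gamma> S a \<phi> \<S> x' y)"
    using AE_has_rate AE_space
  proof eventually_elim
    case (elim y)
    then obtain l where "has_rate y l" by blast
    with elim(2) show ?case
      using limit radius by (auto simp: convergent_def)
  qed
  moreover have "\<exists>c. AE y in \<mu>. \<forall>x\<in>orbit \<Gamma> \<phi> y. cospectral_radius \<Gamma> S a \<phi> \<S> x y = c"
    if const: "\<exists>c. AE y in \<mu>. has_rate y c"
  proof -
    obtain c where "AE y in \<mu>. has_rate y c" using const by blast
    then have "AE y in \<mu>. \<forall>x\<in>orbit \<Gamma> \<phi> y. cospectral_radius \<Gamma> S a \<phi> \<S> x y = exp c"
      using AE_space by eventually_elim (use radius in blast)
    then show ?thesis by blast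
  qed
  moreover have "\<exists>c. AE y in \<mu>. has_rate y c" if "ergodic_relation \<mu> \<S>"
    by (rule rate_const_of_ergodic[OF that E_equiv AE_has_rate _ has_rate_class])
  moreover have "\<exists>c. AE y in \<mu>. has_rate y c"
    if normal: "normal_subrelation \<mu> \<R> \<S>" and ergodic: "ergodic_relation \<mu> \<R>"
  proof (rule rate_const_of_ergodic[OF ergodic, where P = "\<lambda>y l. y \<in> space \<mu> \<and> (\<forall>g\<in>carrier \<Gamma>. has_rate (\<phi> g y) l)"])
    show "equiv (space \<mu>) \<R>"
      unfolding assms(11) by (rule equiv_orbit_relation)
    show "AE y in \<mu>. \<exists>l. y \<in> space \<mu> \<and> (\<forall>g\<in>carrier \<Gamma>. has_rate (\<phi> g y) l)"
      using AE_rate_orbit_invariant normal AE_space unfolding assms(11) by auto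
    show "has_rate y l" if "y \<in> space \<mu> \<and> (\<forall>g\<in>carrier \<Gamma>. has_rate (\<phi> g y) l)" for y l
      using that[THEN conjunct2, rule_format, OF \<Gamma>.one_closed] that by (simp add: act_one)
    show "y' \<in> space \<mu> \<and> (\<forall>g\<in>carrier \<Gamma>. has_rate (\<phi> g y') l)"
      if rel: "(y, y') \<in> \<R>" and y: "y \<in> space \<mu> \<and> (\<forall>g\<in>carrier \<Gamma>. has_rate (\<phi> g y) l)" for y y' l
    proof -
      obtain h where h: "h \<in> carrier \<Gamma>" "y' = \<phi> h y"
        using rel unfolding assms(11) by (rule orbit_relationE)
      have "has_rate (\<phi> g y') l" if g: "g \<in> carrier \<Gamma>" for g
        using y[THEN conjunct2, rule_format, of "g \<otimes>\<^bsub>\<Gamma>\<^esub> h"] y g h by (simp add: composition_rule)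
      then show ?thesis using h y act_space by blast
    qed
  qed
  ultimately show ?thesis by blast
qed

end
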